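(* If $G$ is a graph with $15$ vertices, then at least one of the following holds: $G$ is $3$-compliant; $G$ has a $K_7$ minor; $\overline{G}$ has a $K_7$ minor.
   Context: All graphs are finite, simple and undirected; $\overline{G}$ denotes the complement of $G$. A minor of $G$ is a graph obtained from $G$ by a sequence of vertex deletions, edge deletions and edge contractions. $\Delta(H)$ is the maximum degree of $H$. For an integer $k\ge 1$, a graph $G$ on $n$ vertices is $k$-compliant if $G$ or $\overline{G}$ has a minor $H$ with $\Delta(H)\ge n-k$; otherwise $G$ is $k$-non-compliant. *)

theory Defs
  imports "Graph_Theory.Graph_Theory"
begin

text \<open>
  Finite simple undirected graphs are the \<^locale>\<open>pair_graph\<close>s of the Graph_Theory library:
  finite, loop-free digraphs with a symmetric arc relation, so that an edge \<open>uv\<close> is the pair of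
  arcs \<open>(u, v)\<close>, \<open>(v, u)\<close>.
\<close>

definition complement :: "'a pair_pre_digraph \<Rightarrow> 'a pair_pre_digraph" where
  "complement G = \<lparr> pverts = pverts G,
     parcs = {(u, v). u \<in> pverts G \<and> v \<in> pverts G \<and> u \<noteq> v \<and> (u, v) \<notin> parcs G} \<rparr>"

definition delete_vertex :: "'a pair_pre_digraph \<Rightarrow> 'a \<Rightarrow> 'a pair_pre_digraph" where
  "delete_vertex G v = \<lparr> pverts = pverts G - {v},
     parcs = {(x, y). (x, y) \<in> parcs G \<and> x \<noteq> v \<and> y \<noteq> v} \<rparr>"

definition delete_edge :: "'a pair_pre_digraph \<Rightarrow> 'a \<Rightarrow> 'a \<Rightarrow> 'a pair_pre_digraph" where
  "delete_edge G u v = \<lparr> pverts = pverts G, parcs = parcs G - {(u, v), (v, u)} \<rparr>"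

text \<open>
  The contraction of \<open>uv\<close> keeps the name \<open>u\<close> for the merged vertex. Loops are discarded, and
  parallel edges are identified because the arcs form a set.
\<close>

definition contract_edge :: "'a pair_pre_digraph \<Rightarrow> 'a \<Rightarrow> 'a \<Rightarrow> 'a pair_pre_digraph" where
  "contract_edge G u v = (let f = (\<lambda>x. if x = v then u else x) in
     \<lparr> pverts = pverts G - {v},
       parcs = {(f x, f y) | x y. (x, y) \<in> parcs G \<and> f x \<noteq> f y} \<rparr>)"

inductive minor_step :: "'a pair_pre_digraph \<Rightarrow> 'a pair_pre_digraph \<Rightarrow> bool" where
  del_vertex: "v \<in> pverts G \<Longrightarrow> minor_step G (delete_vertex G v)"
| del_edge: "(u, v) \<in> parcs G \<Longrightarrow> minor_step G (delete_edge G u v)"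
| contract: "(u, v) \<in> parcs G \<Longrightarrow> minor_step G (contract_edge G u v)"

definition is_minor :: "'a pair_pre_digraph \<Rightarrow> 'a pair_pre_digraph \<Rightarrow> bool" where
  "is_minor H G \<longleftrightarrow> minor_step\<^sup>*\<^sup>* G H"

text \<open>
  By symmetry of the arcs, the degree of a vertex is its out-degree. Inserting \<open>0\<close> only matters
  for the graph without vertices, whose maximum degree is thereby \<open>0\<close>.
\<close>

definition max_degree :: "'a pair_pre_digraph \<Rightarrow> nat" where
  "max_degree H = Max (insert 0 (out_degree (with_proj H) ` pverts H))"

text \<open>
  The natural-number subtraction is harmless: for \<open>k\<close> larger than the number of vertices, both it
  and the integer difference bound the degree trivially.
\<close>

definition compliant :: "nat \<Rightarrow> 'a pair_pre_digraph \<Rightarrow> bool" where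
  "compliant k G \<longleftrightarrow>
     (\<exists>H. (is_minor H G \<or> is_minor H (complement G)) \<and> max_degree H \<ge> card (pverts G) - k)"

text \<open>
  \<^const>\<open>complete_digraph\<close> is a predicate that describes the complete graphs up to isomorphism, so
  the vertex names chosen by contractions are irrelevant.
\<close>

definition has_complete_minor :: "nat \<Rightarrow> 'a pair_pre_digraph \<Rightarrow> bool" where
  "has_complete_minor t G \<longleftrightarrow> (\<exists>H. is_minor H G \<and> complete_digraph t (with_proj H))"

lemma pair_graph_iff:
  "pair_graph G \<longleftrightarrow> finite (pverts G) \<and> parcs G \<subseteq> pverts G \<times> pverts G \<and>
     sym (parcs G) \<and> irrefl (parcs G)"
proof
  assume "pair_graph G"
  then interpret pair_graph G .
  show "finite (pverts G) \<and> parcs G \<subseteq> pverts G \<times> pverts G \<and> sym (parcs G) \<and> irrefl (parcs G)"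
    using pair_finite_verts arcs_symmetric no_loops' in_arcsD1 in_arcsD2
    by (auto simp: irrefl_def intro!: symI)
next
  assume *: "finite (pverts G) \<and> parcs G \<subseteq> pverts G \<times> pverts G \<and> sym (parcs G) \<and> irrefl (parcs G)"
  then have "finite (parcs G)"
    by (meson finite_SigmaI finite_subset)
  with * show "pair_graph G"
    by unfold_locales (auto simp: symmetric_def irrefl_def)
qed

lemma pair_graph_complement: "pair_graph G \<Longrightarrow> pair_graph (complement G)"
  by (auto simp: pair_graph_iff complement_def irrefl_def sym_def)

lemma pair_graph_minor_step: "minor_step G H \<Longrightarrow> pair_graph G \<Longrightarrow> pair_graph H"
proof (induction rule: minor_step.induct)
  case (contract u v G)
  then have *: "finite (pverts G)" "parcs G \<subseteq> pverts G \<times> pverts G" "sym (parcs G)"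
      "irrefl (parcs G)" "(u, v) \<in> parcs G"
    by (auto simp: pair_graph_iff)
  then have "u \<noteq> v" "u \<in> pverts G" by (auto simp: irrefl_def)
  with * show ?case
    unfolding pair_graph_iff contract_edge_def Let_def
    by (auto simp: irrefl_def intro!: symI dest: symD split: if_splits) (metis symD)+
qed (auto simp: pair_graph_iff delete_vertex_def delete_edge_def irrefl_def sym_def)

lemma pair_graph_minor: "is_minor H G \<Longrightarrow> pair_graph G \<Longrightarrow> pair_graph H"
  unfolding is_minor_def
  by (induction rule: rtranclp_induct) (auto intro: pair_graph_minor_step)

end

theory Submission
  imports Defs
begin

text \<open>
  If \<open>G\<close> is not 3-compliant, no contraction of an edge or of a path with two edges yields a star with
  12 leaves, in \<open>G\<close> or in its complement. Hence adjacent vertices have a common non-neighbour,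
  non-adjacent ones a common neighbour, a triple with at least two edges has a common non-neighbour,
  and a triple with at most one edge a common neighbour.

  By parity some vertex \<open>v\<close> has degree different from 7, so after passing to the complement if necessary
  its degree is at most 6. Let \<open>A\<close> be the set of its neighbours, and \<open>B\<close> the set of its non-neighbours.
  The triple conditions force \<open>A\<close> to have exactly 6 elements and, after a double count that excludes two
  disjoint triangles, to induce a hexagon. The traces on the hexagon of the 8 vertices of \<open>B\<close> are so
  restricted that, up to symmetry, six of them contain the six rotations of \<open>{0, 1, 3}\<close>. Matching these
  six vertices with the hexagon gives, together with \<open>v\<close>, the branch sets of a complete minor.
\<close>

section \<open>Minors from contractions\<close>

lemma is_minor_step: "is_minor H G \<Longrightarrow> minor_step H K \<Longrightarrow> is_minor K G"
  unfolding is_minor_def by (rule rtranclp.rtrancl_into_rtrancl)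

lemma is_minor_refl: "is_minor G G"
  by (simp add: is_minor_def)

lemma contract_edge_arcI:
  "(x, y) \<in> parcs G \<Longrightarrow> (if x = v then u else x) \<noteq> (if y = v then u else y) \<Longrightarrow>
    ((if x = v then u else x), (if y = v then u else y)) \<in> parcs (contract_edge G u v)"
  unfolding contract_edge_def Let_def pair_pre_digraph.simps mem_Collect_eq by blast

lemma contract_edge_arc_kept:
  "(x, y) \<in> parcs G \<Longrightarrow> x \<noteq> v \<Longrightarrow> y \<noteq> v \<Longrightarrow> x \<noteq> y \<Longrightarrow> (x, y) \<in> parcs (contract_edge G u v)"
  using contract_edge_arcI[of x y G v u] by simp

lemma contract_edge_arc_merged:
  "(v, y) \<in> parcs G \<Longrightarrow> y \<noteq> v \<Longrightarrow> y \<noteq> u \<Longrightarrow> (u, y) \<in> parcs (contract_edge G u v)"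
  using contract_edge_arcI[of v y G v u] by simp

lemma pverts_contract_edge [simp]: "pverts (contract_edge G u v) = pverts G - {v}"
  by (simp add: contract_edge_def Let_def)

lemma card_le_max_degree:
  assumes "pair_graph H" and "v \<in> pverts H" and "N \<subseteq> {w. (v, w) \<in> parcs H}"
  shows "card N \<le> max_degree H"
proof -
  interpret pair_graph H by fact
  have "card N = card (Pair v ` N)"
    by (simp add: card_image inj_on_def)
  also have "\<dots> \<le> card (out_arcs (with_proj H) v)"
    using assms(3) by (intro card_mono) (auto simp: out_arcs_def)
  also have "\<dots> \<le> max_degree H"
    using assms(2) pair_finite_verts unfolding max_degree_def out_degree_def[symmetric]
    by (intro Max_ge finite.insertI finite_imageI insertI2 imageI)
  finally show ?thesis .
qed

text \<open>The merged vertex keeps the name \<open>u\<close> and inherits the neighbours of both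
  ends, so it is the centre of the star.\<close>

lemma contract_edge_star:
  assumes G: "pair_graph G" and uw: "(u, w) \<in> parcs G"
    and N: "N \<subseteq> pverts G - {u, w}" "\<And>x. x \<in> N \<Longrightarrow> (u, x) \<in> parcs G \<or> (w, x) \<in> parcs G"
  shows "\<exists>H. is_minor H G \<and> card N \<le> max_degree H"
proof (intro exI conjI)
  show minor: "is_minor (contract_edge G u w) G"
    using is_minor_step[OF is_minor_refl minor_step.contract[OF uw]] .
  have ends: "u \<in> pverts G" "u \<noteq> w"
    using G uw by (auto simp: pair_graph_iff irrefl_def)
  show "card N \<le> max_degree (contract_edge G u w)"
  proof (rule card_le_max_degree)
    show "pair_graph (contract_edge G u w)" using pair_graph_minor[OF minor G] .
    show "u \<in> pverts (contract_edge G u w)" using ends by simp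
    show "N \<subseteq> {x. (u, x) \<in> parcs (contract_edge G u w)}"
    proof
      fix x assume "x \<in> N"
      then have "(u, x) \<in> parcs G \<or> (w, x) \<in> parcs G" "x \<noteq> u" "x \<noteq> w"
        using N by auto
      then show "x \<in> {x. (u, x) \<in> parcs (contract_edge G u w)}"
        using ends(2) contract_edge_arc_kept[of u x G w u] contract_edge_arc_merged[of w x G u]
        by auto
    qed
  qed
qed

text \<open>Merging \<open>u\<close> into the middle vertex \<open>v\<close> leaves an edge from
  \<open>v\<close> to \<open>w\<close>, so the case of a single edge finishes the
  contraction.\<close>

lemma contract_path_star:
  assumes G: "pair_graph G" and path: "(v, u) \<in> parcs G" "(v, w) \<in> parcs G" "u \<noteq> w"
    and N: "N \<subseteq> pverts G - {u, v, w}"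
      "\<And>x. x \<in> N \<Longrightarrow> (u, x) \<in> parcs G \<or> (v, x) \<in> parcs G \<or> (w, x) \<in> parcs G"
  shows "\<exists>H. is_minor H G \<and> card N \<le> max_degree H"
proof -
  let ?G = "contract_edge G v u"
  have minor: "is_minor ?G G"
    using is_minor_step[OF is_minor_refl minor_step.contract[OF path(1)]] .
  have ends: "v \<noteq> w" "v \<noteq> u"
    using G path by (auto simp: pair_graph_iff irrefl_def)
  have "\<exists>H. is_minor H ?G \<and> card N \<le> max_degree H"
  proof (rule contract_edge_star)
    show "pair_graph ?G" using pair_graph_minor[OF minor G] .
    show "(v, w) \<in> parcs ?G"
      using contract_edge_arc_kept[OF path(2), of u v] ends path(3) by simp
    show "N \<subseteq> pverts ?G - {v, w}" using N(1) by auto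
    fix x assume "x \<in> N"
    then have "(u, x) \<in> parcs G \<or> (v, x) \<in> parcs G \<or> (w, x) \<in> parcs G"
      "x \<noteq> u" "x \<noteq> v" "x \<noteq> w"
      using N by auto
    then show "(v, x) \<in> parcs ?G \<or> (w, x) \<in> parcs ?G"
      using ends path(3) contract_edge_arc_kept[of v x G u v] contract_edge_arc_kept[of w x G u v]
        contract_edge_arc_merged[of u x G v] by auto
  qed
  then show ?thesis
    using minor unfolding is_minor_def by (meson rtranclp_trans)
qed

text \<open>Only the survival of arcs is recorded. For a complete minor the arcs are bounded from
  above by the absence of loops.\<close>

lemma induced_minor:
  assumes "finite W" and "W \<subseteq> pverts G"
  shows "\<exists>H. is_minor H G \<and> pverts H = pverts G - W \<and>
    (\<forall>x y. (x, y) \<in> parcs G \<longrightarrow> x \<notin> W \<longrightarrow> y \<notin> W \<longrightarrow> (x, y) \<in> parcs H)"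
  using assms
proof (induction W)
  case empty
  then show ?case using is_minor_refl by auto
next
  case (insert w W)
  then obtain H where H: "is_minor H G" "pverts H = pverts G - W"
    "\<forall>x y. (x, y) \<in> parcs G \<longrightarrow> x \<notin> W \<longrightarrow> y \<notin> W \<longrightarrow> (x, y) \<in> parcs H"
    by auto
  have "is_minor (delete_vertex H w) G"
    using is_minor_step[OF H(1) minor_step.del_vertex] H(2) insert by auto
  then show ?case
    using H(2,3) by (intro exI[of _ "delete_vertex H w"]) (auto simp: delete_vertex_def)
qed

text \<open>\<open>v\<close> and the pairs \<open>{a i, b i}\<close> are the branch sets of a complete minor.\<close>

definition matching_model :: "nat \<Rightarrow> 'a set \<Rightarrow> ('a \<Rightarrow> 'a \<Rightarrow> bool) \<Rightarrow> 'a \<Rightarrow> (nat \<Rightarrow> 'a) \<Rightarrow> (nat \<Rightarrow> 'a) \<Rightarrow> bool"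
  where "matching_model n V E v a b \<longleftrightarrow>
    v \<in> V \<and> a ` {..<n} \<subseteq> V - {v} \<and> b ` {..<n} \<subseteq> V - {v} - a ` {..<n} \<and>
    inj_on a {..<n} \<and> inj_on b {..<n} \<and> (\<forall>i<n. E v (a i) \<and> E (a i) (b i)) \<and>
    (\<forall>i<n. \<forall>j<i. E (a i) (a j) \<or> E (a i) (b j) \<or> E (b i) (a j))"

section \<open>Contracting the edges of a matching\<close>

fun contract_matching :: "'a pair_pre_digraph \<Rightarrow> (nat \<Rightarrow> 'a) \<Rightarrow> (nat \<Rightarrow> 'a) \<Rightarrow> nat \<Rightarrow> 'a pair_pre_digraph" where
  "contract_matching G a b 0 = G"
| "contract_matching G a b (Suc m) = contract_edge (contract_matching G a b m) (a m) (b m)"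

text \<open>Follows \<open>x\<close> through the first \<open>m\<close> contractions: the value is
  the name of the merged vertex that contains it.\<close>

fun branch_of :: "(nat \<Rightarrow> 'a) \<Rightarrow> (nat \<Rightarrow> 'a) \<Rightarrow> nat \<Rightarrow> 'a \<Rightarrow> 'a" where
  "branch_of a b 0 x = x"
| "branch_of a b (Suc m) x = (if branch_of a b m x = b m then a m else branch_of a b m x)"

lemma contract_matching_arcI:
  "(x, y) \<in> parcs G \<Longrightarrow> branch_of a b m x \<noteq> branch_of a b m y \<Longrightarrow>
    (branch_of a b m x, branch_of a b m y) \<in> parcs (contract_matching G a b m)"
proof (induction m)
  case (Suc m)
  then have "branch_of a b m x \<noteq> branch_of a b m y" by (metis branch_of.simps(2))
  then have "(branch_of a b m x, branch_of a b m y) \<in> parcs (contract_matching G a b m)"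
    using Suc by blast
  from contract_edge_arcI[OF this, of "b m" "a m"] Suc.prems show ?case by simp
qed simp

text \<open>The contractions do not interfere: no \<open>a i\<close> is also some
  \<open>b m\<close>, so each \<open>b i\<close> is renamed exactly once.\<close>

lemma branch_of_simps:
  assumes "inj_on b {..<n}" and "b ` {..<n} \<inter> a ` {..<n} = {}" and "m \<le> n"
  shows "x \<notin> b ` {..<m} \<Longrightarrow> branch_of a b m x = x"
    and "i < m \<Longrightarrow> branch_of a b m (b i) = a i"
proof -
  show *: "x \<notin> b ` {..<m} \<Longrightarrow> branch_of a b m x = x" for x m
    by (induction m) (auto simp: lessThan_Suc)
  show "i < m \<Longrightarrow> branch_of a b m (b i) = a i"
    using assms(3)
  proof (induction m)
    case (Suc m)
    show ?case
    proof (cases "i = m")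
      case True
      then have "b i \<notin> b ` {..<m}"
        using assms(1) Suc.prems inj_on_image_mem_iff[of b "{..<n}" i "{..<m}"] by auto
      then show ?thesis using * True by simp
    next
      case False
      then have "branch_of a b m (b i) = a i" using Suc by simp
      moreover have "a i \<noteq> b m" using assms(2) Suc.prems by force
      ultimately show ?thesis by simp
    qed
  qed simp
qed

text \<open>After the contractions the branch sets bear the names \<open>v\<close> and
  \<open>a i\<close>. Deleting all other vertices leaves \<open>Suc n\<close> pairwise adjacent
  ones.\<close>

lemma complete_minor_of_matching_model:
  assumes G: "pair_graph G" and M: "matching_model n (pverts G) (\<lambda>x y. (x, y) \<in> parcs G) v a b"
  shows "has_complete_minor (Suc n) G"
proof -
  let ?cm = "contract_matching G a b" and ?br = "branch_of a b"
  have sym: "(y, x) \<in> parcs G" if "(x, y) \<in> parcs G" for x y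
    using G that by (auto simp: pair_graph_iff sym_def)
  have inj: "inj_on a {..<n}" "inj_on b {..<n}" and disj: "b ` {..<n} \<inter> a ` {..<n} = {}"
    and v: "v \<in> pverts G" "v \<notin> a ` {..<n}" "v \<notin> b ` {..<n}"
    and va: "\<And>i. i < n \<Longrightarrow> (v, a i) \<in> parcs G" and ab: "\<And>i. i < n \<Longrightarrow> (a i, b i) \<in> parcs G"
    and aV: "a ` {..<n} \<subseteq> pverts G"
    and aa: "\<And>i j. i < n \<Longrightarrow> j < i \<Longrightarrow>
      (a i, a j) \<in> parcs G \<or> (a i, b j) \<in> parcs G \<or> (b i, a j) \<in> parcs G"
    using M unfolding matching_model_def by blast+
  have br_id: "x \<notin> b ` {..<m} \<Longrightarrow> ?br m x = x" and br_b: "i < m \<Longrightarrow> ?br m (b i) = a i"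
    if "m \<le> n" for m x i
    using branch_of_simps[OF inj(2) disj that] by auto
  have minor: "is_minor (?cm m) G \<and> pverts (?cm m) = pverts G - b ` {..<m}" if "m \<le> n" for m
    using that
  proof (induction m)
    case 0
    then show ?case by (simp add: is_minor_refl)
  next
    case (Suc m)
    have "a m \<notin> b ` {..<m}" using disj Suc.prems by force
    moreover have "b m \<notin> b ` {..<m}"
      using inj(2) Suc.prems inj_on_image_mem_iff[of b "{..<n}" m "{..<m}"] by auto
    ultimately have id: "?br m (a m) = a m" "?br m (b m) = b m"
      using br_id[of m] Suc.prems by auto
    moreover have "a m \<noteq> b m" using disj Suc.prems by force
    ultimately have "(a m, b m) \<in> parcs (?cm m)"
      using contract_matching_arcI[of "a m" "b m" G a b m] ab[of m] Suc.prems by simp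
    then have "is_minor (?cm (Suc m)) G"
      using Suc is_minor_step[OF _ minor_step.contract] by auto
    then show ?case using Suc by (auto simp: lessThan_Suc)
  qed
  have fin: "finite (pverts G)" using G by (simp add: pair_graph_iff)
  define K where "K = insert v (a ` {..<n})"
  have KV: "K \<subseteq> pverts (?cm n)"
    using minor[of n] v aV disj by (auto simp: K_def)
  obtain H where H: "is_minor H (?cm n)" "pverts H = pverts (?cm n) - (pverts (?cm n) - K)"
    "\<forall>x y. (x, y) \<in> parcs (?cm n) \<longrightarrow> x \<notin> pverts (?cm n) - K \<longrightarrow> y \<notin> pverts (?cm n) - K \<longrightarrow> (x, y) \<in> parcs H"
    using induced_minor[of "pverts (?cm n) - K" "?cm n"] minor[of n] fin by auto
  have pvH: "pverts H = K" using H(2) KV by auto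
  have HG: "is_minor H G"
    using H(1) minor[of n] unfolding is_minor_def by (meson order_refl rtranclp_trans)
  then have "pair_graph H" using pair_graph_minor G by blast
  \<comment> \<open>These are all loop-free arcs on \<open>K\<close>, so it remains to find each of
    them in \<open>H\<close>.\<close>
  then have H_sub: "parcs H \<subseteq> {(x, y). (x, y) \<in> K \<times> K \<and> x \<noteq> y}"
    and H_sym: "\<And>x y. (x, y) \<in> parcs H \<Longrightarrow> (y, x) \<in> parcs H"
    using pvH by (auto simp: pair_graph_iff irrefl_def sym_def)
  have HI: "(?br n x, ?br n y) \<in> parcs H"
    if "(x, y) \<in> parcs G" "?br n x \<in> K" "?br n y \<in> K" "?br n x \<noteq> ?br n y" for x y
    using H(3) contract_matching_arcI[OF that(1,4)] that(2,3) by blast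
  have br_v: "?br n v = v" using br_id[of n v] v by simp
  have br_a: "?br n (a i) = a i" if "i < n" for i
    using br_id[of n "a i"] disj that by auto
  have aK: "a i \<in> K" if "i < n" for i using that by (auto simp: K_def)
  have H_va: "(v, a i) \<in> parcs H" if "i < n" for i
    using HI[OF va[OF that]] br_v br_a[OF that] aK[OF that] v that by (auto simp: K_def)
  have H_aa: "(a i, a j) \<in> parcs H" if "i < n" "j < i" for i j
  proof -
    have "j < n" "a i \<noteq> a j" using that inj_onD[OF inj(1), of i j] by auto
    then show ?thesis
      using aa[OF that] HI[of "a i" "a j"] HI[of "a i" "b j"] HI[of "b i" "a j"]
      unfolding br_a[OF that(1)] br_a[OF \<open>j < n\<close>] br_b[OF order_refl that(1)]
        br_b[OF order_refl \<open>j < n\<close>]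
      using aK[OF that(1)] aK[OF \<open>j < n\<close>] by blast
  qed
  have H_aa': "(a i, a j) \<in> parcs H" if "i < n" "j < n" "a i \<noteq> a j" for i j
  proof (cases "i < j")
    case True
    then show ?thesis using H_aa[of j i] H_sym that by auto
  next
    case False
    then have "j < i" using that by (cases "i = j") auto
    then show ?thesis using H_aa that by auto
  qed
  have "parcs H = {(x, y). (x, y) \<in> K \<times> K \<and> x \<noteq> y}"
  proof (intro equalityI H_sub subsetI)
    fix e assume e: "e \<in> {(x, y). (x, y) \<in> K \<times> K \<and> x \<noteq> y}"
    obtain x y where xy: "e = (x, y)" by (cases e)
    consider "x = v" "y = v" | i where "x = v" "i < n" "y = a i" | i where "i < n" "x = a i" "y = v"
      | i j where "i < n" "j < n" "x = a i" "y = a j"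
      using e xy unfolding K_def by blast
    then show "e \<in> parcs H"
      using e xy H_va H_aa' H_sym by cases auto
  qed
  moreover have "card K = Suc n"
    using v inj by (simp add: K_def card_image)
  ultimately have "complete_digraph (Suc n) (with_proj H)"
    using pvH by (simp add: complete_digraph_pair_def K_def)
  then show ?thesis using HG by (auto simp: has_complete_minor_def)
qed

section \<open>Traces on a hexagon\<close>

lemma all_less_6: "(\<forall>i<6. P i) \<longleftrightarrow> P 0 \<and> P 1 \<and> P 2 \<and> P 3 \<and> P 4 \<and> P (5::nat)"
  by (simp add: numeral_eq_Suc All_less_Suc conj_ac)

lemma all_less_8: "(\<forall>i<8. P i) \<longleftrightarrow> P 0 \<and> P 1 \<and> P 2 \<and> P 3 \<and> P 4 \<and> P 5 \<and> P 6 \<and> P (7::nat)"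
  by (simp add: numeral_eq_Suc All_less_Suc conj_ac)

lemma ex_less_6: "(\<exists>i<6. P i) \<longleftrightarrow> P 0 \<or> P 1 \<or> P 2 \<or> P 3 \<or> P 4 \<or> P (5::nat)"
  by (simp add: numeral_eq_Suc Ex_less_Suc disj_ac)

lemma ex_less_8: "(\<exists>i<8. P i) \<longleftrightarrow> P 0 \<or> P 1 \<or> P 2 \<or> P 3 \<or> P 4 \<or> P 5 \<or> P 6 \<or> P (7::nat)"
  by (simp add: numeral_eq_Suc Ex_less_Suc disj_ac)

lemma all_less_3: "(\<forall>i<3. P i) \<longleftrightarrow> P 0 \<and> P 1 \<and> P (2::nat)"
  by (simp add: numeral_eq_Suc All_less_Suc conj_ac)

lemma less_6_cases: "i < 6 \<Longrightarrow> i = 0 \<or> i = 1 \<or> i = 2 \<or> i = 3 \<or> i = 4 \<or> i = (5::nat)"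
  by linarith

lemmas less_unfold = all_less_3 all_less_6 all_less_8 ex_less_6 ex_less_8

text \<open>The encoding: \<open>S k i\<close> says that the \<open>k\<close>-th vertex of \<open>B\<close> is adjacent to the \<open>i\<close>-th vertex of
  the hexagon \<open>A\<close>, and below \<open>M k l\<close> says that the \<open>k\<close>-th and \<open>l\<close>-th vertices of \<open>B\<close> are adjacent. The
  vertices of \<open>B\<close> are numbered so that number \<open>i < 6\<close> misses the edge \<open>{i, i + 1}\<close> of the hexagon. Each
  of the two negated assumptions excludes a complete minor.\<close>

locale hexagon_code =
  fixes S :: "nat \<Rightarrow> nat \<Rightarrow> bool"
  assumes hit: "\<forall>k<8. \<forall>i<6. S k i \<or> S k ((i + 1) mod 6) \<or> S k ((i + 2) mod 6)"
    and hit': "\<forall>k<8. \<forall>i<3. \<exists>j<6. j mod 3 \<noteq> i \<and> S k j"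
    and base: "\<forall>i<6. \<not> S i i \<and> \<not> S i ((i + 1) mod 6)"
    and meet: "\<forall>k<8. \<forall>l<8. k < l \<longrightarrow> (\<exists>i<6. S k i \<and> S l i)"
    and miss: "\<forall>i<6. \<exists>k<8. \<not> S k i \<and> \<not> S k ((i + 2) mod 6)"
    and miss': "\<forall>i<3. \<forall>l<8. \<exists>k<8. k \<noteq> l \<and> \<not> S k i \<and> \<not> S k (i + 3)"
    and neg: "\<not> (\<forall>i<6. S i ((i + 4) mod 6))" "\<not> (\<forall>i<6. S i ((i + 3) mod 6))"
begin

text \<open>Bounded quantifiers become propositional formulas. The last rewriting restores
  \<open>2\<close>, so that equal atoms are also syntactically equal.\<close>

lemmas code_facts =
  hit[simplified less_unfold, simplified, simplified numeral_2_eq_2[symmetric]]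
  hit'[simplified less_unfold, simplified, simplified numeral_2_eq_2[symmetric]]
  base[simplified less_unfold, simplified, simplified numeral_2_eq_2[symmetric]]
  meet[simplified less_unfold, simplified, simplified numeral_2_eq_2[symmetric]]
  miss[simplified less_unfold, simplified, simplified numeral_2_eq_2[symmetric]]
  miss'[simplified less_unfold, simplified, simplified numeral_2_eq_2[symmetric]]
  neg[simplified less_unfold, simplified, simplified numeral_2_eq_2[symmetric]]

text \<open>A propositional consequence of the traces alone; adjacencies inside \<open>B\<close> do
  not enter. Numbers 6 and 7 are the ones not tied to a missed edge.\<close>

lemma alternating:
  "(\<not> S 6 0 \<and> S 6 1 \<and> \<not> S 6 2 \<and> S 6 3 \<and> \<not> S 6 4 \<and> S 6 5) \<or>
  (\<not> S 7 0 \<and> S 7 1 \<and> \<not> S 7 2 \<and> S 7 3 \<and> \<not> S 7 4 \<and> S 7 5) \<or>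
  (S 6 0 \<and> \<not> S 6 1 \<and> S 6 2 \<and> \<not> S 6 3 \<and> S 6 4 \<and> \<not> S 6 5) \<or>
  (S 7 0 \<and> \<not> S 7 1 \<and> S 7 2 \<and> \<not> S 7 3 \<and> S 7 4 \<and> \<not> S 7 5)"
  \<comment> \<open>The simplified facts contain \<open>Suc 0\<close> in place of \<open>1\<close>,
    and the atoms of the goal have to match.\<close>
  unfolding One_nat_def using code_facts by satx

end

text \<open>The families are triple conditions: \<open>antipodal\<close> for two opposite hexagon
  vertices and one vertex of \<open>B\<close>, \<open>nbr\<close> and its complementary form
  \<open>non_nbr\<close> for one hexagon vertex and two vertices of \<open>B\<close>. Offsets 1 and
  5 are the hexagon neighbours of \<open>i\<close>; offsets 2, 3, 4 are its non-neighbours.\<close>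

locale hexagon_code_edges = hexagon_code +
  fixes M :: "nat \<Rightarrow> nat \<Rightarrow> bool"
  assumes M_commute: "M k l \<longleftrightarrow> M l k"
    and antipodal: "\<forall>i<3. \<forall>k<8. S k i \<and> S k (i + 3) \<or> (\<exists>l<8. l \<noteq> k \<and> M k l \<and> S l i \<and> S l (i + 3))"
    and nbr: "\<forall>i<6. \<forall>k<8. \<forall>l<8. k < l \<longrightarrow> S k i \<and> S l i \<or> S k i \<and> M k l \<or> S l i \<and> M k l \<or>
      S k ((i + 1) mod 6) \<and> S l ((i + 1) mod 6) \<or> S k ((i + 5) mod 6) \<and> S l ((i + 5) mod 6) \<or>
      (\<exists>m<8. m \<noteq> k \<and> m \<noteq> l \<and> S m i \<and> M k m \<and> M l m)"
    and non_nbr: "\<forall>i<6. \<forall>k<8. \<forall>l<8. k < l \<longrightarrow> \<not> S k i \<and> \<not> S l i \<or> \<not> S k i \<and> \<not> M k l \<or> \<not> S l i \<and> \<not> M k l \<or>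
      (\<exists>j\<in>{2, 3, 4}. \<not> S k ((i + j) mod 6) \<and> \<not> S l ((i + j) mod 6)) \<or>
      (\<exists>m<8. m \<noteq> k \<and> m \<noteq> l \<and> \<not> S m i \<and> \<not> M k m \<and> \<not> M l m)"
begin

text \<open>The instances below form an unsatisfiable core, found by a search. The full families would make
  the propositional proof very slow.\<close>

lemmas nbr_at = nbr[rule_format] and non_nbr_at = non_nbr[rule_format] and antipodal_at = antipodal[rule_format]

lemmas edge_insts =
    nbr_at[of 0 0 5] nbr_at[of 0 1 7] nbr_at[of 1 0 1] nbr_at[of 1 3 6] nbr_at[of 1 4 6]
    nbr_at[of 2 1 2] nbr_at[of 4 0 4] nbr_at[of 4 1 7] nbr_at[of 4 2 3] nbr_at[of 4 4 5]
    nbr_at[of 5 1 6] nbr_at[of 5 2 6] nbr_at[of 5 4 6]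
    non_nbr_at[of 0 1 4] non_nbr_at[of 0 1 7] non_nbr_at[of 1 0 2] non_nbr_at[of 1 0 5]
    non_nbr_at[of 1 1 2] non_nbr_at[of 1 1 4] non_nbr_at[of 1 1 5] non_nbr_at[of 1 2 4]
    non_nbr_at[of 1 2 5] non_nbr_at[of 2 0 1] non_nbr_at[of 2 0 2] non_nbr_at[of 2 0 3]
    non_nbr_at[of 2 3 7] non_nbr_at[of 2 4 7] non_nbr_at[of 2 5 7] non_nbr_at[of 3 0 4]
    non_nbr_at[of 3 1 4] non_nbr_at[of 3 1 5] non_nbr_at[of 4 0 2] non_nbr_at[of 4 2 5]
    non_nbr_at[of 4 2 7] non_nbr_at[of 5 1 5]
    antipodal_at[of 0 0] antipodal_at[of 0 2] antipodal_at[of 1 0] antipodal_at[of 1 1]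
    antipodal_at[of 1 3] antipodal_at[of 1 4] antipodal_at[of 1 6] antipodal_at[of 1 7]
    antipodal_at[of 2 1] antipodal_at[of 2 2] antipodal_at[of 2 6] antipodal_at[of 2 7]

lemmas edge_facts =
  edge_insts[simplified less_unfold, simplified, simplified M_commute numeral_2_eq_2[symmetric]]

text \<open>Refuting one of the four outcomes of \<open>alternating\<close> suffices: any
  alternating vertex can be given the number 6, and a rotation of the hexagon exchanges the two
  parities.\<close>

lemma not_alternating: "\<not> (\<not> S 6 0 \<and> S 6 1 \<and> \<not> S 6 2 \<and> S 6 3 \<and> \<not> S 6 4 \<and> S 6 5)"
  unfolding One_nat_def using code_facts edge_facts by satx

end

section \<open>Neighbourhoods in a non-compliant graph\<close>

lemma sum_indicator: "finite X \<Longrightarrow> (\<Sum>e\<in>X. if P e then 1 else 0) = card {e \<in> X. P e}"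
  by (simp add: sum.If_cases Int_def)

text \<open>Abstract in \<open>V\<close> and \<open>E\<close>, so that the complement is another
  instance. A vertex is not adjacent to itself, so only the conditions on common non-neighbours have
  to exclude the given vertices explicitly.\<close>

locale noncompliant =
  fixes V :: "'a set" and E :: "'a \<Rightarrow> 'a \<Rightarrow> bool"
  assumes card_V: "card V = 15"
    and E_sym: "E x y \<Longrightarrow> E y x"
    and E_irrefl: "\<not> E x x"
    and adj_pair: "u \<in> V \<Longrightarrow> w \<in> V \<Longrightarrow> E u w \<Longrightarrow>
      \<exists>x\<in>V. x \<notin> {u, w} \<and> \<not> E x u \<and> \<not> E x w"
    and nonadj_pair: "u \<in> V \<Longrightarrow> w \<in> V \<Longrightarrow> u \<noteq> w \<Longrightarrow> \<not> E u w \<Longrightarrow> \<exists>x\<in>V. E x u \<and> E x w"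
    and adj_path: "u \<in> V \<Longrightarrow> v \<in> V \<Longrightarrow> w \<in> V \<Longrightarrow> u \<noteq> w \<Longrightarrow> E u v \<Longrightarrow> E v w \<Longrightarrow>
      \<exists>x\<in>V. x \<notin> {u, v, w} \<and> \<not> E x u \<and> \<not> E x v \<and> \<not> E x w"
    and nonadj_path: "u \<in> V \<Longrightarrow> v \<in> V \<Longrightarrow> w \<in> V \<Longrightarrow> distinct [u, v, w] \<Longrightarrow> \<not> E u v \<Longrightarrow> \<not> E v w \<Longrightarrow>
      \<exists>x\<in>V. E x u \<and> E x v \<and> E x w"
begin

lemma finite_V: "finite V"
  using card_V card.infinite by fastforce

lemma E_commute: "E x y \<longleftrightarrow> E y x"
  using E_sym by blast

text \<open>Passing to the complement exchanges \<open>adj_pair\<close> with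
  \<open>nonadj_pair\<close> and \<open>adj_path\<close> with \<open>nonadj_path\<close>.\<close>

lemma complement_noncompliant: "noncompliant V (\<lambda>x y. x \<noteq> y \<and> \<not> E x y)"
proof unfold_locales
  fix u w assume uw: "u \<in> V" "w \<in> V"
  show "\<exists>x\<in>V. x \<notin> {u, w} \<and> \<not> (x \<noteq> u \<and> \<not> E x u) \<and> \<not> (x \<noteq> w \<and> \<not> E x w)"
    if non: "u \<noteq> w \<and> \<not> E u w"
  proof -
    obtain x where "x \<in> V" "E x u" "E x w" using nonadj_pair[OF uw] non by blast
    then show ?thesis using E_irrefl by (intro bexI[of _ x]) auto
  qed
  show "\<exists>x\<in>V. (x \<noteq> u \<and> \<not> E x u) \<and> (x \<noteq> w \<and> \<not> E x w)"
    if "u \<noteq> w" "\<not> (u \<noteq> w \<and> \<not> E u w)"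
    using adj_pair[OF uw] that by auto
  fix y assume y: "y \<in> V"
  show "\<exists>x\<in>V. x \<notin> {u, w, y} \<and> \<not> (x \<noteq> u \<and> \<not> E x u) \<and> \<not> (x \<noteq> w \<and> \<not> E x w) \<and> \<not> (x \<noteq> y \<and> \<not> E x y)"
    if non: "u \<noteq> y" "u \<noteq> w \<and> \<not> E u w" "w \<noteq> y \<and> \<not> E w y"
  proof -
    obtain x where "x \<in> V" "E x u" "E x w" "E x y" using nonadj_path[OF uw y] non by auto
    then show ?thesis using E_irrefl by (intro bexI[of _ x]) auto
  qed
  show "\<exists>x\<in>V. (x \<noteq> u \<and> \<not> E x u) \<and> (x \<noteq> w \<and> \<not> E x w) \<and> (x \<noteq> y \<and> \<not> E x y)"
    if "distinct [u, w, y]" "\<not> (u \<noteq> w \<and> \<not> E u w)" "\<not> (w \<noteq> y \<and> \<not> E w y)"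
    using adj_path[OF uw y] that by auto
next
  show "card V = 15" by (fact card_V)
  show "y \<noteq> x \<and> \<not> E y x" if "x \<noteq> y \<and> \<not> E x y" for x y using that E_commute[of x y] by auto
qed simp

text \<open>Given a first common non-neighbour \<open>y\<close>, the triple \<open>u\<close>,
  \<open>y\<close>, \<open>w\<close> has a common neighbour \<open>x\<close>. A common non-neighbour
  of the path \<open>u\<close>, \<open>x\<close>, \<open>w\<close> differs from \<open>y\<close>,
  which is adjacent to \<open>x\<close>.\<close>

lemma two_common_non_nbrs:
  assumes "u \<in> V" "w \<in> V" "u \<noteq> w"
  shows "\<exists>x\<in>V. \<exists>y\<in>V. x \<noteq> y \<and> {x, y} \<inter> {u, w} = {} \<and>
    \<not> E x u \<and> \<not> E x w \<and> \<not> E y u \<and> \<not> E y w"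
proof -
  obtain y where y: "y \<in> V" "y \<notin> {u, w}" "\<not> E y u" "\<not> E y w"
  proof (cases "E u w")
    case True
    then show ?thesis using adj_pair[of u w] assms that by blast
  next
    case False
    then obtain x where "x \<in> V" "E x u" "E x w" using nonadj_pair assms by blast
    then show ?thesis using adj_path[of u x w] assms that E_sym by blast
  qed
  then obtain x where x: "x \<in> V" "E x u" "E x y" "E x w"
    using nonadj_path[of u y w] assms y(1,2) y(3,4)[unfolded E_commute[of y]] E_commute[of y u] by auto
  then obtain y' where "y' \<in> V" "y' \<notin> {u, x, w}" "\<not> E y' u" "\<not> E y' x" "\<not> E y' w"
    using adj_path[of u x w] assms E_sym by blast
  moreover have "y' \<noteq> y" using calculation x E_sym by blast
  ultimately show ?thesis using y by blast
qed

end

section \<open>The neighbourhood \<open>A\<close> and the non-neighbourhood \<open>B\<close> of a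
  vertex\<close>

locale noncompliant_at = noncompliant +
  fixes v :: 'a
  assumes v_in: "v \<in> V"
begin

abbreviation A :: "'a set" where "A \<equiv> {a \<in> V. E v a}"
abbreviation B :: "'a set" where "B \<equiv> {b \<in> V. b \<noteq> v \<and> \<not> E v b}"

lemma card_A_B: "card A + card B = 14"
proof -
  have "V = insert v (A \<union> B)" "v \<notin> A \<union> B" "A \<inter> B = {}"
    using v_in E_irrefl by auto
  then have "card V = Suc (card A + card B)"
    using finite_V by (metis (no_types, lifting) card_Un_disjoint card_insert_disjoint finite_Un finite_insert)
  then show ?thesis using card_V by simp
qed

text \<open>The path \<open>a\<close>, \<open>v\<close>, \<open>a'\<close> has a common
  non-neighbour, which lies in \<open>B\<close> because it misses \<open>v\<close>.\<close>

lemma miss2: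
  assumes "a \<in> A" "a' \<in> A" "a \<noteq> a'"
  shows "\<exists>b\<in>B. \<not> E a b \<and> \<not> E a' b"
  using adj_path[of a v a'] assms v_in E_sym by blast

text \<open>As \<open>v\<close> misses \<open>b\<close> and \<open>b'\<close>, the three have a
  common neighbour, which lies in \<open>A\<close>.\<close>

lemma meet:
  assumes "b \<in> B" "b' \<in> B"
  shows "\<exists>a\<in>A. E a b \<and> E a b'"
proof (cases "b = b'")
  case True
  then show ?thesis using nonadj_pair[of v b] assms v_in E_sym by blast
next
  case False
  have "\<exists>x\<in>V. E x b \<and> E x v \<and> E x b'"
    using assms v_in E_sym False by (intro nonadj_path) auto
  then show ?thesis using E_sym by blast
qed

text \<open>If \<open>b\<close> misses \<open>a\<close> as well as \<open>v\<close>, the triple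
  \<open>v\<close>, \<open>b\<close>, \<open>a\<close> has a common neighbour.\<close>

lemma dominated:
  assumes "a \<in> A" "b \<in> B"
  shows "E a b \<or> (\<exists>a'\<in>A. E a a' \<and> E a' b)"
proof (rule disjCI)
  assume "\<not> (\<exists>a'\<in>A. E a a' \<and> E a' b)"
  then have "\<not> (\<exists>x\<in>V. E x v \<and> E x b \<and> E x a)" using E_sym by blast
  moreover have "v \<in> V" "b \<in> V" "a \<in> V" "distinct [v, b, a]" "\<not> E v b"
    using assms v_in E_irrefl by auto
  ultimately have "E b a" using nonadj_path by blast
  then show "E a b" by (rule E_sym)
qed

section \<open>Dominating paths and the lower bound on the degree\<close>

definition dominating_path :: "'a \<Rightarrow> 'a \<Rightarrow> 'a \<Rightarrow> bool" where
  "dominating_path x y z \<longleftrightarrow> {x, y, z} \<subseteq> A \<and> x \<noteq> z \<and> E x y \<and> E y z \<and>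
    (\<forall>u\<in>A - {x, y, z}. E u x \<or> E u y \<or> E u z)"

text \<open>The common non-neighbour of the path is neither \<open>v\<close>, which is adjacent to
  all of \<open>A\<close>, nor in \<open>A\<close>, which the path dominates.\<close>

lemma dominating_path_missed:
  assumes "dominating_path x y z"
  shows "\<exists>b\<in>B. \<not> E x b \<and> \<not> E y b \<and> \<not> E z b"
proof -
  obtain w where w: "w \<in> V" "w \<notin> {x, y, z}" "\<not> E w x" "\<not> E w y" "\<not> E w z"
    using adj_path[of x y z] assms unfolding dominating_path_def by blast
  then have "w \<in> B" using assms unfolding dominating_path_def by blast
  then show ?thesis using w E_sym by blast
qed

text \<open>Some \<open>b'\<close> misses the whole path, and \<open>b\<close> must meet it in
  \<open>A\<close>.\<close>

lemma dominating_path_left: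
  assumes "dominating_path x y z" "b \<in> B"
  shows "\<exists>u\<in>A - {x, y, z}. E u b"
proof -
  obtain b' where "b' \<in> B" "\<not> E x b'" "\<not> E y b'" "\<not> E z b'"
    using dominating_path_missed assms by blast
  then show ?thesis using meet[of b b'] assms by blast
qed

text \<open>Apply \<open>dominated\<close> twice: to some \<open>b\<close> missed by
  \<open>a\<close>, giving \<open>x\<close>, and then to some \<open>b'\<close> missed by both
  \<open>a\<close> and \<open>x\<close>, so that the new neighbour \<open>y\<close> is not
  \<open>x\<close>.\<close>

lemma two_nbrs_in_A:
  assumes "a \<in> A"
  shows "\<exists>x\<in>A. \<exists>y\<in>A. x \<noteq> y \<and> E a x \<and> E a y"
proof -
  obtain b where b: "b \<in> B" "\<not> E a b"
    using adj_pair[of v a] assms v_in E_sym by blast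
  then obtain x where x: "x \<in> A" "E a x" using dominated[OF assms] by blast
  then have "a \<noteq> x" using E_irrefl by blast
  then obtain b' where b': "b' \<in> B" "\<not> E a b'" "\<not> E x b'" using miss2[OF assms x(1)] by blast
  then obtain y where y: "y \<in> A" "E a y" "E y b'" using dominated[OF assms b'(1)] by blast
  have "x \<noteq> y" using y(3) b'(3) by metis
  then show ?thesis using x y by blast
qed

text \<open>The common non-neighbour of the path \<open>x\<close>, \<open>a\<close>,
  \<open>y\<close> is not in \<open>B\<close>: by \<open>dominated\<close>, every vertex of
  \<open>B\<close> is adjacent to \<open>a\<close> or to one of its only neighbours
  \<open>x\<close>, \<open>y\<close> in \<open>A\<close>.\<close>

lemma undominated_in_A:
  assumes "a \<in> A" "x \<in> A" "y \<in> A" "x \<noteq> y" "E a x" "E a y"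
    and nbrs: "\<And>u. u \<in> A \<Longrightarrow> E a u \<Longrightarrow> u = x \<or> u = y"
  shows "\<exists>z\<in>A - {a, x, y}. \<not> E z a \<and> \<not> E z x \<and> \<not> E z y"
proof -
  obtain z where z: "z \<in> V" "z \<notin> {x, a, y}" "\<not> E z x" "\<not> E z a" "\<not> E z y"
    using adj_path[of x a y] assms E_sym by blast
  have "z \<notin> B" using dominated[of a z] z nbrs assms(1) E_sym by blast
  moreover have "z \<noteq> v" using z assms by blast
  ultimately show ?thesis using z by blast
qed

text \<open>With at most five vertices, each vertex of \<open>A\<close> misses at most one other, so
  every triple forms a dominating path. A vertex \<open>b\<close> missed by one triple has at most
  two neighbours in \<open>A\<close>, and a triple covering these contradicts
  \<open>dominating_path_left\<close>.\<close>

lemma card_A_ge: "6 \<le> card A"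
proof (rule ccontr)
  assume small: "\<not> 6 \<le> card A"
  have fin: "finite A" using finite_V by simp
  have most: "E u x \<or> E u y" if u: "u \<in> A" "x \<in> A" "y \<in> A" "distinct [u, x, y]" for u x y
  proof (rule ccontr)
    assume non: "\<not> ?thesis"
    obtain p q where pq: "p \<in> A" "q \<in> A" "p \<noteq> q" "E u p" "E u q"
      using two_nbrs_in_A u by blast
    have dist: "distinct [u, x, y, p, q]" using pq non u E_irrefl by auto
    have "{u, x, y, p, q} \<subseteq> A" using pq u by blast
    moreover have "card {u, x, y, p, q} = 5" using dist by simp
    ultimately have A: "A = {u, x, y, p, q}"
      using small fin card_subset_eq[of A "{u, x, y, p, q}"] card_mono[of A "{u, x, y, p, q}"] by auto
    have "w = p \<or> w = q" if "w \<in> A" "E u w" for w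
      using that(2) that(1)[unfolded A] non E_irrefl by auto
    \<comment> \<open>By elimination \<open>z\<close> is \<open>x\<close> or \<open>y\<close>. Its
      only possible neighbour in \<open>A\<close> is the other one, against
      \<open>two_nbrs_in_A\<close>.\<close>
    then obtain z where z: "z \<in> A" "z \<notin> {u, p, q}" "\<not> E z u" "\<not> E z p" "\<not> E z q"
      using undominated_in_A[OF u(1) pq(1,2,3,4,5)] by blast
    obtain s t where st: "s \<in> A" "t \<in> A" "s \<noteq> t" "E z s" "E z t"
      using two_nbrs_in_A[OF z(1)] by blast
    show False
      using z st(3-5) E_irrefl st(1,2)[unfolded A] z(1)[unfolded A] by auto
  qed
  have path: "dominating_path x y z \<or> dominating_path y z x \<or> dominating_path z x y"
    if "x \<in> A" "y \<in> A" "z \<in> A" "distinct [x, y, z]" for x y z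
  proof -
    have "E u x \<or> E u y \<or> E u z" if "u \<in> A - {x, y, z}" for u
      using most[of u x y] that \<open>x \<in> A\<close> \<open>y \<in> A\<close> \<open>distinct [x, y, z]\<close> by auto
    \<comment> \<open>So at least two of the three pairs are adjacent, and some vertex is the middle
      of a path.\<close>
    moreover have "E x y \<or> E x z" "E y x \<or> E y z" "E z x \<or> E z y"
      using most[of x y z] most[of y x z] most[of z x y] that by auto
    ultimately show ?thesis
      using that E_commute[of x y] E_commute[of x z] E_commute[of y z]
      unfolding dominating_path_def by auto
  qed
  have missed: "\<exists>b\<in>B. \<not> E x b \<and> \<not> E y b \<and> \<not> E z b"
    if "x \<in> A" "y \<in> A" "z \<in> A" "distinct [x, y, z]" for x y z
    using path[OF that] dominating_path_missed by blast
  have left: "\<exists>u\<in>A - {x, y, z}. E u b"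
    if "x \<in> A" "y \<in> A" "z \<in> A" "distinct [x, y, z]" "b \<in> B" for x y z b
    using path[OF that(1-4)] dominating_path_left[OF _ that(5)] by blast
  have "A \<noteq> {}"
  proof -
    have "V \<noteq> {v}" using card_V by auto
    then obtain u where "u \<in> V" "u \<noteq> v" using v_in by blast
    then show ?thesis using nonadj_pair[of v u] v_in E_sym by blast
  qed
  then obtain a where a: "a \<in> A" by blast
  then obtain x y where xy: "x \<in> A" "y \<in> A" "x \<noteq> y" "E a x" "E a y"
    using two_nbrs_in_A by blast
  have dist: "distinct [a, x, y]" using xy E_irrefl by auto
  obtain b where b: "b \<in> B" "\<not> E a b" "\<not> E x b" "\<not> E y b"
    using missed[OF a xy(1,2) dist] by blast
  obtain p where p: "p \<in> A - {a, x, y}" "E p b"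
    using left[OF a xy(1,2) dist b(1)] by blast
  show False
  proof (cases "A \<subseteq> {a, x, y, p}")
    case True
    have "\<exists>u\<in>A - {p, a, x}. E u b" using left[of p a x b] p a xy dist b by auto
    then show False using True b by blast
  next
    case False
    then obtain q where q: "q \<in> A - {a, x, y, p}" by blast
    have "{a, x, y, p, q} \<subseteq> A" "card {a, x, y, p, q} = 5" using a xy dist p q by auto
    then have A: "A = {a, x, y, p, q}"
      using small fin card_subset_eq[of A "{a, x, y, p, q}"] card_mono[of A "{a, x, y, p, q}"] by auto
    have "\<exists>u\<in>A - {p, q, a}. E u b" using left[of p q a b] p q a b by auto
    then show False using A b by blast
  qed
qed

text \<open>A dominating path is missed by some \<open>b \<in> B\<close>, all of whose neighbours in \<open>A\<close> then lie in the
  complement of the path. This complement is therefore dominating, and it cannot be connected, since no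
  vertex of \<open>B\<close> has all its neighbours in \<open>A\<close> on a dominating path.\<close>

lemma path_complement:
  assumes A: "A = {x, y, z, p, q, r}" and dist: "distinct [x, y, z, p, q, r]"
    and path: "E x y" "E y z"
    and dom: "E p x \<or> E p y \<or> E p z" "E q x \<or> E q y \<or> E q z" "E r x \<or> E r y \<or> E r z"
  shows "\<not> (E p q \<and> E q r)" and "E x p \<or> E x q \<or> E x r"
    and "E y p \<or> E y q \<or> E y r" and "E z p \<or> E z q \<or> E z r"
proof -
  have "dominating_path x y z"
    using dist path dom unfolding dominating_path_def A by auto
  then obtain b where b: "b \<in> B" "\<not> E x b" "\<not> E y b" "\<not> E z b"
    using dominating_path_missed by blast
  have in_A: "x \<in> A" "y \<in> A" "z \<in> A" unfolding A by simp_all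
  have dom': "E w p \<or> E w q \<or> E w r" if "w \<in> A" "\<not> E w b" for w
    using dominated[OF that(1) b(1)] that(2) b(2-4) unfolding A by auto
  then show *: "E x p \<or> E x q \<or> E x r" "E y p \<or> E y q \<or> E y r" "E z p \<or> E z q \<or> E z r"
    using in_A b by blast+
  show "\<not> (E p q \<and> E q r)"
  proof
    assume "E p q \<and> E q r"
    then have "dominating_path p q r"
      using dist * unfolding dominating_path_def A by auto
    then obtain u where "u \<in> A - {p, q, r}" "E u b"
      using dominating_path_left[OF _ b(1)] by blast
    then show False using b unfolding A by auto
  qed
qed

section \<open>The graph induced on a neighbourhood of six vertices\<close>

lemma A_enum:
  assumes "card A = 6" "{x, y, z} \<subseteq> A" "distinct [x, y, z]"
  obtains p q r where "A = {x, y, z, p, q, r}" "distinct [x, y, z, p, q, r]"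
proof -
  have "card (A - {x, y, z}) = 3"
    using assms finite_V by (subst card_Diff_subset) auto
  then obtain p q r where *: "A - {x, y, z} = {p, q, r}" "distinct [p, q, r]"
    by (auto simp: card_3_iff)
  have "A = {x, y, z} \<union> (A - {x, y, z})" using assms(2) by blast
  then have "A = {x, y, z, p, q, r}" unfolding *(1) by auto
  moreover have "{p, q, r} \<inter> {x, y, z} = {}" unfolding *(1)[symmetric] by blast
  then have "distinct [x, y, z, p, q, r]" using *(2) assms(3) by auto
  ultimately show thesis by (rule that)
qed

text \<open>Otherwise \<open>dense\<close> makes \<open>p\<close> adjacent to \<open>x\<close>,
  \<open>y\<close>, \<open>z\<close>, and any two of these form a dominating path through
  \<open>p\<close>. By \<open>path_complement\<close> the third misses \<open>q\<close> or
  \<open>r\<close>. But \<open>q\<close> and \<open>r\<close> already miss \<open>p\<close>, so each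
  misses at most one of \<open>x\<close>, \<open>y\<close>, \<open>z\<close>.\<close>

lemma no_isolated:
  assumes A: "A = {x, y, z, p, q, r}" and dist: "distinct [x, y, z, p, q, r]"
    and dense: "\<And>s t u w. {s, t, u, w} \<subseteq> A \<Longrightarrow> distinct [s, t, u, w] \<Longrightarrow> E s t \<or> E s u \<or> E s w"
  shows "E p q \<or> E p r"
proof (rule ccontr)
  assume iso: "\<not> ?thesis"
  have d: "E s t \<or> E s u \<or> E s w"
    if "distinct [s, t, u, w]" "{s, t, u, w} \<subseteq> {x, y, z, p, q, r}" for s t u w
    using dense[of s t u w] that A by simp
  have p: "E p x" "E p y" "E p z"
    using d[of p q r x] d[of p q r y] d[of p q r z] dist iso by auto
  have *: "\<not> (E q z' \<and> E z' r)"
    if "A = {x', p, y', q, z', r}" "distinct [x', p, y', q, z', r]" "E p x'" "E p y'" for x' y' z'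
  proof (rule path_complement(1)[OF that(1,2)])
    show "E x' p" "E p y'" using that E_commute by auto
    show "E q x' \<or> E q p \<or> E q y'" "E z' x' \<or> E z' p \<or> E z' y'" "E r x' \<or> E r p \<or> E r y'"
      using dense[of q x' p y'] dense[of z' x' p y'] dense[of r x' p y'] that(2) unfolding that(1) by auto
  qed
  have "A = {y, p, z, q, x, r}" "A = {x, p, z, q, y, r}" "A = {x, p, y, q, z, r}"
    unfolding A by auto
  then have "\<not> (E q x \<and> E x r)" "\<not> (E q y \<and> E y r)" "\<not> (E q z \<and> E z r)"
    using *[of y z x] *[of x z y] *[of x y z] dist p by auto
  moreover have "E q x \<or> E q y" "E q x \<or> E q z" "E q y \<or> E q z" "E r x \<or> E r y" "E r x \<or> E r z" "E r y \<or> E r z"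
    using d[of q p x y] d[of q p x z] d[of q p y z] d[of r p x y] d[of r p x z] d[of r p y z]
      dist iso E_commute by auto
  ultimately show False using E_commute[of x r] E_commute[of y r] E_commute[of z r] by blast
qed

text \<open>If no vertex missed three others, every path on three vertices would dominate
  \<open>A\<close>. The other three vertices would then contain no path by
  \<open>path_complement\<close>, but also no isolated vertex by \<open>no_isolated\<close>, which
  is impossible.\<close>

lemma sparse_vertex:
  assumes "card A = 6"
  shows "\<exists>s t u w. {s, t, u, w} \<subseteq> A \<and> distinct [s, t, u, w] \<and> \<not> E s t \<and> \<not> E s u \<and> \<not> E s w"
proof (rule ccontr)
  assume "\<not> ?thesis"
  then have dense: "E s t \<or> E s u \<or> E s w" if "{s, t, u, w} \<subseteq> A" "distinct [s, t, u, w]" for s t u w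
    using that by blast
  have "A \<noteq> {}" using assms card.empty by force
  then obtain y where y: "y \<in> A" by blast
  then obtain x z where xz: "x \<in> A" "z \<in> A" "x \<noteq> z" "E y x" "E y z" using two_nbrs_in_A by blast
  then have "{x, y, z} \<subseteq> A" "distinct [x, y, z]" using y E_irrefl by auto
  then obtain p q r where A: "A = {x, y, z, p, q, r}" and dist: "distinct [x, y, z, p, q, r]"
    using A_enum assms by blast
  have "E p q \<or> E p r" "E q p \<or> E q r" "E r p \<or> E r q"
    using no_isolated[of x y z p q r] no_isolated[of x y z q p r] no_isolated[of x y z r p q] A dist dense
    by auto
  moreover have "\<not> (E p q \<and> E q r)" "\<not> (E q p \<and> E p r)" "\<not> (E p r \<and> E r q)"
  proof -
    have dom: "E w x \<or> E w y \<or> E w z" if "w \<in> {p, q, r}" for w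
      using dense[of w x y z] dist that unfolding A by auto
    show "\<not> (E p q \<and> E q r)" "\<not> (E q p \<and> E p r)" "\<not> (E p r \<and> E r q)"
      using path_complement(1)[of x y z p q r] path_complement(1)[of x y z q p r] path_complement(1)[of x y z p r q] A dist xz dom
        E_commute[of x y] by (auto simp: insert_commute)
  qed
  ultimately show False using E_commute[of p q] E_commute[of p r] E_commute[of q r] by blast
qed

text \<open>A vertex \<open>a\<close> missing three others has exactly two neighbours
  \<open>x\<close>, \<open>y\<close>. Then \<open>undominated_in_A\<close> gives a vertex
  \<open>w\<close> missing all three, whose neighbours are the remaining \<open>p\<close>,
  \<open>q\<close>. The final alternatives are two disjoint triangles, or a hexagon in one of two
  cyclic orders.\<close>

lemma A_structure:
  assumes "card A = 6"
  obtains a x y w p q where "A = {a, x, y, w, p, q}" "distinct [a, x, y, w, p, q]"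
    "E a x" "E a y" "\<not> E a w" "\<not> E a p" "\<not> E a q" "\<not> E w x" "\<not> E w y" "E w p" "E w q"
    "E x y \<and> E p q \<or> \<not> E x y \<and> \<not> E p q \<and> (E x p \<and> E y q \<and> \<not> E x q \<and> \<not> E y p \<or> E x q \<and> E y p \<and> \<not> E x p \<and> \<not> E y q)"
proof -
  obtain a r s t where arst: "{a, r, s, t} \<subseteq> A" "distinct [a, r, s, t]" "\<not> E a r" "\<not> E a s" "\<not> E a t"
    using sparse_vertex assms by blast
  obtain x y where xy: "x \<in> A" "y \<in> A" "x \<noteq> y" "E a x" "E a y"
    using two_nbrs_in_A[of a] arst by blast
  have "{a, x, y, r, s, t} \<subseteq> A" using xy arst by blast
  moreover have dist: "distinct [a, x, y, r, s, t]" using xy arst E_irrefl by auto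
  then have "card {a, x, y, r, s, t} = card A" using assms by simp
  ultimately have A: "A = {a, x, y, r, s, t}"
    using finite_V card_subset_eq[of A "{a, x, y, r, s, t}"] by simp
  have nbrs: "u = x \<or> u = y" if "u \<in> A" "E a u" for u
    using that(2) that(1)[unfolded A] arst E_irrefl by auto
  obtain w where w: "w \<in> A" "w \<notin> {a, x, y}" "\<not> E w a" "\<not> E w x" "\<not> E w y"
    using undominated_in_A[of a x y] xy arst nbrs by blast
  obtain p q where pq: "p \<in> A" "q \<in> A" "p \<noteq> q" "E w p" "E w q"
    using two_nbrs_in_A[OF w(1)] by blast
  have pq': "p \<notin> {a, x, y, w}" "q \<notin> {a, x, y, w}"
    using pq w E_irrefl by auto
  have "{a, x, y, w, p, q} \<subseteq> A" using xy arst w pq by blast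
  moreover have dist: "distinct [a, x, y, w, p, q]" using pq pq' w dist by auto
  then have "card {a, x, y, w, p, q} = card A" using assms by simp
  ultimately have A: "A = {a, x, y, w, p, q}"
    using finite_V card_subset_eq[of A "{a, x, y, w, p, q}"] by simp
  have non: "\<not> E a w" "\<not> E a p" "\<not> E a q"
    using nbrs[OF w(1)] nbrs[OF pq(1)] nbrs[OF pq(2)] w(2) pq' by auto
  \<comment> \<open>Of the two neighbours of \<open>s\<close> in \<open>A\<close>, at least one is
    different from \<open>m\<close>, and neither is \<open>k\<close>.\<close>
  have deg: "E s t \<or> E s u \<or> E s n" if "A = {s, t, u, n, k, m}" "\<not> E s k" for s t u n k m
  proof -
    have "s \<in> A" unfolding that by simp
    from two_nbrs_in_A[OF this] obtain c d where "c \<in> A" "d \<in> A" "c \<noteq> d" "E s c" "E s d" by blast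
    then show ?thesis using that(2) E_irrefl unfolding that(1) by auto
  qed
  \<comment> \<open>The path \<open>c\<close>, \<open>u\<close>, \<open>r\<close> dominates
    \<open>A\<close>. So \<open>d\<close>, \<open>r'\<close>, \<open>u'\<close> is not a path, and
    \<open>u\<close> has a neighbour among these three other than \<open>d\<close>.\<close>
  have step: "\<not> E r' u' \<and> (E u u' \<or> E u r')"
    if "A = {c, u, r, u', d, r'}" "distinct [c, u, r, u', d, r']" "E c u" "E c u'" "E d r" "E d r'"
      "\<not> E u d" "E u r" "E r' u \<or> E r' r" for c d u u' r r'
  proof -
    have "A = {c, u, r, d, r', u'}" unfolding that(1) by auto
    moreover have "E u' c" using that E_sym by blast
    ultimately show ?thesis
      using path_complement(1,3)[of c u r d r' u'] that by auto
  qed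
  have c: "E x a" "E y a" "E p w" "E q w" "\<not> E x w" "\<not> E y w" "\<not> E p a" "\<not> E q a"
    "E y x \<longleftrightarrow> E x y" "E q p \<longleftrightarrow> E p q" "E p x \<longleftrightarrow> E x p" "E q x \<longleftrightarrow> E x q" "E p y \<longleftrightarrow> E y p" "E q y \<longleftrightarrow> E y q"
    using xy pq non w E_commute by metis+
  have deg_xypq: "E x y \<or> E x p \<or> E x q" "E x y \<or> E y p \<or> E y q" "E p q \<or> E x p \<or> E y p" "E p q \<or> E x q \<or> E y q"
    using deg[of x y p q w a] deg[of y x p q w a] deg[of p q x y a w] deg[of q p x y a w] A c
    by (auto simp: insert_commute)
  \<comment> \<open>The symmetries of the configuration: swapping \<open>x\<close> and
    \<open>y\<close>, swapping \<open>p\<close> and \<open>q\<close>, and exchanging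
    \<open>a\<close> and its neighbours with \<open>w\<close> and its neighbours.\<close>
  have perms: "A = {a, x, p, y, w, q}" "A = {a, x, q, y, w, p}" "A = {a, y, p, x, w, q}" "A = {a, y, q, x, w, p}"
    "A = {w, p, x, q, a, y}" "A = {w, q, x, p, a, y}" "A = {w, p, y, q, a, x}" "A = {w, q, y, p, a, x}"
    unfolding A by auto
  have step1: "\<not> E y q \<and> (E x y \<or> E x q)" if "E x p" "E x q \<or> E p q"
    using step[OF perms(1)] dist xy(4,5) pq(4,5) c that by auto
  have step2: "\<not> E y p \<and> (E x y \<or> E x p)" if "E x q" "E x p \<or> E p q"
    using step[OF perms(2)] dist xy(4,5) pq(4,5) c that by auto
  have step3: "\<not> E x q \<and> (E x y \<or> E y q)" if "E y p" "E y q \<or> E p q"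
    using step[OF perms(3)] dist xy(4,5) pq(4,5) c that by auto
  have step4: "\<not> E x p \<and> (E x y \<or> E y p)" if "E y q" "E y p \<or> E p q"
    using step[OF perms(4)] dist xy(4,5) pq(4,5) c that by auto
  have step5: "\<not> E y q \<and> (E p q \<or> E y p)" if "E x p" "E y p \<or> E x y"
    using step[OF perms(5)] dist xy(4,5) pq(4,5) c that by auto
  have step6: "\<not> E y p \<and> (E p q \<or> E y q)" if "E x q" "E y q \<or> E x y"
    using step[OF perms(6)] dist xy(4,5) pq(4,5) c that by auto
  have step7: "\<not> E x q \<and> (E p q \<or> E x p)" if "E y p" "E x p \<or> E x y"
    using step[OF perms(7)] dist xy(4,5) pq(4,5) c that by auto
  have step8: "\<not> E x p \<and> (E p q \<or> E x q)" if "E y q" "E x q \<or> E x y"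
    using step[OF perms(8)] dist xy(4,5) pq(4,5) c that by auto
  have "E x y \<and> E p q \<or> \<not> E x y \<and> \<not> E p q \<and> (E x p \<and> E y q \<and> \<not> E x q \<and> \<not> E y p \<or> E x q \<and> E y p \<and> \<not> E x p \<and> \<not> E y q)"
    using deg_xypq step1 step2 step3 step4 step5 step6 step7 step8 by satx
  then show thesis
    using that[OF A dist xy(4,5) non w(4,5) pq(4,5)] by blast
qed

text \<open>The vertices from \<open>two_common_non_nbrs\<close> avoid \<open>v\<close>, which is
  adjacent to \<open>u\<close>, and avoid \<open>A\<close> by \<open>dom\<close>.\<close>

lemma card_missing_both:
  assumes "u \<in> A" "t \<in> A" "u \<noteq> t" and dom: "\<And>z. z \<in> A \<Longrightarrow> z \<in> {u, t} \<or> E z u \<or> E z t"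
  shows "2 \<le> card {b \<in> B. \<not> E u b \<and> \<not> E t b}"
proof -
  obtain x y where xy: "x \<in> V" "y \<in> V" "x \<noteq> y" "{x, y} \<inter> {u, t} = {}"
    "\<not> E x u" "\<not> E x t" "\<not> E y u" "\<not> E y t"
    using two_common_non_nbrs[of u t] assms(1-3) by blast
  have "x \<noteq> v" "y \<noteq> v" using xy(5,7) assms(1) by auto
  moreover have "x \<notin> A" "y \<notin> A" using dom[of x] dom[of y] xy by auto
  ultimately have "{x, y} \<subseteq> {b \<in> B. \<not> E u b \<and> \<not> E t b}"
    using xy E_sym by blast
  from card_mono[OF _ this] show ?thesis using xy(3) finite_V by simp
qed

text \<open>Count the triples of \<open>u\<close> in one triangle, \<open>t\<close> in the other and
  \<open>b\<close> in \<open>B\<close> missing both. Each of the nine pairs dominates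
  \<open>A\<close>, so it occurs at least twice, giving 18. Each of the eight \<open>b\<close>
  occurs at most twice, giving 16.\<close>

lemma no_two_triangles:
  assumes "card A = 6" and A: "A = {a, x, y, w, p, q}" and dist: "distinct [a, x, y, w, p, q]"
    and tri: "E a x" "E a y" "E x y" "E w p" "E w q" "E p q"
    and non: "\<not> E a w" "\<not> E a p" "\<not> E a q" "\<not> E w x" "\<not> E w y"
  shows False
proof -
  let ?T = "{a, x, y}" and ?U = "{w, p, q}"
  have finB: "finite B" using finite_V by simp
  have cardB: "card B = 8" using card_A_B assms(1) by simp
  have sym: "E x a" "E y a" "E y x" "E p w" "E q w" "E q p" using tri E_sym by blast+
  have missed: "2 \<le> card {b \<in> B. \<not> E u b \<and> \<not> E t b}" if "u \<in> ?T" "t \<in> ?U" for u t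
  proof (rule card_missing_both)
    show "u \<in> A" "t \<in> A" "u \<noteq> t" using that dist unfolding A by auto
    show "z \<in> {u, t} \<or> E z u \<or> E z t" if "z \<in> A" for z
      using that \<open>u \<in> ?T\<close> \<open>t \<in> ?U\<close> tri sym unfolding A by auto
  qed
  define S where "S b = {u \<in> ?T. E u b}" for b
  define S' where "S' b = {u \<in> ?U. E u b}" for b
  have le2: "card ((?T - S b) \<times> (?U - S' b)) \<le> 2" if b: "b \<in> B" for b
  proof -
    have "a \<in> A" "w \<in> A" using A by auto
    \<comment> \<open>All neighbours of \<open>a\<close> in \<open>A\<close> lie in
      \<open>?T\<close> and those of \<open>w\<close> in \<open>?U\<close>, so
      \<open>dominated\<close> finds a neighbour of \<open>b\<close> in each triangle.\<close>
    then have "S b \<noteq> {}" "S' b \<noteq> {}"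
      using dominated[OF _ b, of a] dominated[OF _ b, of w] non unfolding S_def S'_def A
      using E_commute[of a w] by auto
    moreover have fin: "finite (S b)" "finite (S' b)" unfolding S_def S'_def by auto
    ultimately have ge: "1 \<le> card (S b)" "1 \<le> card (S' b)" by (simp_all add: Suc_le_eq card_gt_0_iff)
    \<comment> \<open>If \<open>u\<close> and \<open>t\<close> were the only neighbours of
      \<open>b\<close> in \<open>A\<close>, some \<open>b'\<close> missing both could not meet
      \<open>b\<close>.\<close>
    have not1: "\<not> (card (S b) = 1 \<and> card (S' b) = 1)"
    proof
      assume "card (S b) = 1 \<and> card (S' b) = 1"
      then obtain u t where ut: "S b = {u}" "S' b = {t}" by (metis card_1_singletonE)
      then have "u \<in> ?T" "t \<in> ?U" unfolding S_def S'_def by auto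
      then have "{b \<in> B. \<not> E u b \<and> \<not> E t b} \<noteq> {}" using missed[of u t] by (metis card.empty not_numeral_le_zero)
      then obtain b' where b': "b' \<in> B" "\<not> E u b'" "\<not> E t b'" by blast
      obtain z where "z \<in> A" "E z b" "E z b'" using meet[OF b b'(1)] by blast
      then have "z \<in> S b \<union> S' b" unfolding S_def S'_def A by auto
      then show False using ut b' \<open>E z b'\<close> by auto
    qed
    have sub: "S b \<subseteq> ?T" "S' b \<subseteq> ?U" unfolding S_def S'_def by auto
    have "card ?T = 3" "card ?U = 3" using dist by auto
    then have "card (?T - S b) = 3 - card (S b)" "card (?U - S' b) = 3 - card (S' b)"
      using fin sub by (simp_all only: card_Diff_subset)
    then have "card ((?T - S b) \<times> (?U - S' b)) = (3 - card (S b)) * (3 - card (S' b))"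
      by (simp add: card_cartesian_product)
    also have "\<dots> \<le> 2"
    proof (cases "card (S b) = 1")
      case True
      then have "3 - card (S' b) \<le> 1" using ge not1 by linarith
      then show ?thesis using True by simp
    next
      case False
      then have "3 - card (S b) \<le> 1" "3 - card (S' b) \<le> 2" using ge by linarith+
      from mult_le_mono[OF this] show ?thesis by simp
    qed
    finally show ?thesis .
  qed
  have "18 = (\<Sum>e\<in>?T \<times> ?U. 2)" using dist by (simp add: card_cartesian_product)
  also have "\<dots> \<le> (\<Sum>e\<in>?T \<times> ?U. card {b \<in> B. \<not> E (fst e) b \<and> \<not> E (snd e) b})"
    using missed by (intro sum_mono) auto
  also have "\<dots> = (\<Sum>e\<in>?T \<times> ?U. \<Sum>b\<in>B. if \<not> E (fst e) b \<and> \<not> E (snd e) b then 1 else 0)"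
    by (intro sum.cong refl sum_indicator[OF finB, symmetric])
  also have "\<dots> = (\<Sum>b\<in>B. \<Sum>e\<in>?T \<times> ?U. if \<not> E (fst e) b \<and> \<not> E (snd e) b then 1 else 0)"
    by (rule sum.swap)
  also have "\<dots> = (\<Sum>b\<in>B. card ((?T - S b) \<times> (?U - S' b)))"
  proof (rule sum.cong[OF refl])
    fix b
    have "(?T - S b) \<times> (?U - S' b) = {e \<in> ?T \<times> ?U. \<not> E (fst e) b \<and> \<not> E (snd e) b}"
      unfolding S_def S'_def by auto
    then show "(\<Sum>e\<in>?T \<times> ?U. if \<not> E (fst e) b \<and> \<not> E (snd e) b then 1 else 0) = card ((?T - S b) \<times> (?U - S' b))"
      using sum_indicator[of "?T \<times> ?U" "\<lambda>e. \<not> E (fst e) b \<and> \<not> E (snd e) b"] by (simp only: finite_cartesian_product finite.intros)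
  qed
  also have "\<dots> \<le> (\<Sum>b\<in>B. 2)" using le2 by (rule sum_mono)
  also have "\<dots> = 16" using cardB by simp
  finally show False by simp
qed

end

section \<open>The hexagon\<close>

locale hexagon = noncompliant_at +
  fixes a :: "nat \<Rightarrow> 'a"
  assumes a_image: "a ` {..<6} = A" and a_inj: "inj_on a {..<6}"
    and a_adj: "i < 6 \<Longrightarrow> j < 6 \<Longrightarrow> E (a i) (a j) \<longleftrightarrow> j = (i + 1) mod 6 \<or> i = (j + 1) mod 6"
begin

lemma a_in: "i < 6 \<Longrightarrow> a i \<in> A"
  using a_image by blast

lemma in_A_obtain:
  assumes "z \<in> A"
  obtains i where "i < 6" "z = a i"
  using assms a_image by blast

lemma a_eq: "i < 6 \<Longrightarrow> j < 6 \<Longrightarrow> a i = a j \<longleftrightarrow> i = j"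
  using a_inj by (auto simp: inj_on_def)

lemma card_B: "card B = 8"
  using card_A_B card_image[OF a_inj] a_image by simp

text \<open>Apply \<open>dominated\<close> to the middle one of the three positions, whose hexagon
  neighbours are the other two.\<close>

lemma hit:
  assumes "b \<in> B" "i < 6"
  shows "E (a i) b \<or> E (a ((i + 1) mod 6)) b \<or> E (a ((i + 2) mod 6)) b"
proof (rule ccontr)
  assume none: "\<not> ?thesis"
  then obtain z where z: "z \<in> A" "E (a ((i + 1) mod 6)) z" "E z b"
    using dominated[OF a_in assms(1), of "(i + 1) mod 6"] by auto
  then obtain j where j: "j < 6" "z = a j" using in_A_obtain by blast
  have "j = (i + 2) mod 6 \<or> j = i"
    using z(2) a_adj[of "(i + 1) mod 6" j] j less_6_cases[OF assms(2)] less_6_cases[OF j(1)] by auto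
  then show False using none z j by auto
qed

text \<open>Opposite vertices dominate the hexagon, so at least two vertices of \<open>B\<close>
  miss both, and one of these is not \<open>l\<close>.\<close>

lemma antipodal_missed:
  assumes "i < 3"
  shows "\<exists>b\<in>B. b \<noteq> l \<and> \<not> E (a i) b \<and> \<not> E (a (i + 3)) b"
proof (rule ccontr)
  assume "\<not> ?thesis"
  then have "{b \<in> B. \<not> E (a i) b \<and> \<not> E (a (i + 3)) b} \<subseteq> {l}" by blast
  from card_mono[OF _ this] have "card {b \<in> B. \<not> E (a i) b \<and> \<not> E (a (i + 3)) b} \<le> 1" by simp
  moreover have "2 \<le> card {b \<in> B. \<not> E (a i) b \<and> \<not> E (a (i + 3)) b}"
  proof (rule card_missing_both)
    show "a i \<in> A" "a (i + 3) \<in> A" "a i \<noteq> a (i + 3)" using assms a_in a_eq by auto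
    fix z assume "z \<in> A"
    then obtain j where j: "j < 6" "z = a j" using in_A_obtain by blast
    have "i = 0 \<or> i = 1 \<or> i = 2" using assms by linarith
    then show "z \<in> {a i, a (i + 3)} \<or> E z (a i) \<or> E z (a (i + 3))"
      using less_6_cases[OF j(1)] j(2) a_adj[of j i] a_adj[of j "i + 3"] by auto
  qed
  ultimately show False by simp
qed

text \<open>Here \<open>b\<close> meets some \<open>b'\<close> that misses both \<open>a i\<close>
  and \<open>a (i + 3)\<close>; the residue modulo 3 identifies antipodal positions.\<close>

lemma hit_off_antipodal:
  assumes "b \<in> B" "i < 3"
  shows "\<exists>j<6. j mod 3 \<noteq> i \<and> E (a j) b"
proof -
  obtain b' where b': "b' \<in> B" "\<not> E (a i) b'" "\<not> E (a (i + 3)) b'"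
    using antipodal_missed[OF assms(2)] by blast
  obtain z where z: "z \<in> A" "E z b" "E z b'" using meet[OF assms(1) b'(1)] by blast
  then obtain j where j: "j < 6" "z = a j" using in_A_obtain by blast
  then have "j \<noteq> i" "j \<noteq> i + 3" using z b' by auto
  then have "j mod 3 \<noteq> i" using j(1) assms(2) by presburger
  then show ?thesis using z j by blast
qed

text \<open>If \<open>b\<close> misses one of the two opposite vertices, the triple has a common
  neighbour. It is not on the hexagon, where opposite vertices share no neighbour, and not
  \<open>v\<close>, which misses \<open>b\<close>.\<close>

lemma antipodal_common:
  assumes b: "b \<in> B" and "i < 3"
  shows "E (a i) b \<and> E (a (i + 3)) b \<or> (\<exists>b'\<in>B. b' \<noteq> b \<and> E b b' \<and> E (a i) b' \<and> E (a (i + 3)) b')"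
proof (rule disjCI)
  assume no: "\<not> (\<exists>b'\<in>B. b' \<noteq> b \<and> E b b' \<and> E (a i) b' \<and> E (a (i + 3)) b')"
  have i3: "i = 0 \<or> i = 1 \<or> i = 2" using assms by linarith
  have V: "a i \<in> V" "a (i + 3) \<in> V" "b \<in> V" using a_in[of i] a_in[of "i + 3"] assms by auto
  have ne: "a i \<noteq> a (i + 3)" "b \<noteq> a i" "b \<noteq> a (i + 3)"
    using a_eq[of i "i + 3"] a_in[of i] a_in[of "i + 3"] assms by auto
  have non: "\<not> E (a i) (a (i + 3))" "\<not> E (a (i + 3)) (a i)"
    using a_adj[of i "i + 3"] a_adj[of "i + 3" i] i3 by auto
  have "False" if x: "x \<in> V" "E x (a i)" "E x (a (i + 3))" "E x b" for x
  proof -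
    have "x \<noteq> v" using x b by auto
    moreover have "x \<notin> A"
    proof
      assume "x \<in> A"
      then obtain j where j: "j < 6" "x = a j" using in_A_obtain by blast
      then show False using x i3 less_6_cases[OF j(1)] a_adj[of j i] a_adj[of j "i + 3"] by auto
    qed
    ultimately have "x \<in> B" using x by blast
    moreover have "x \<noteq> b" using x E_irrefl by blast
    ultimately show False using no x E_sym by blast
  qed
  then have "\<not> (\<exists>x\<in>V. E x (a i) \<and> E x (a (i + 3)) \<and> E x b)" "\<not> (\<exists>x\<in>V. E x (a (i + 3)) \<and> E x (a i) \<and> E x b)"
    by blast+
  then show "E (a i) b \<and> E (a (i + 3)) b"
    using nonadj_path[OF V] nonadj_path[OF V(2,1,3)] ne non by auto
qed

text \<open>The first three disjuncts cover triples with at least two edges. Otherwise there is a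
  common neighbour, which lies at position \<open>i + 1\<close> or \<open>i + 5\<close> of the
  hexagon or in \<open>B\<close>.\<close>

lemma common_nbr:
  assumes b: "b \<in> B" "b' \<in> B" "b \<noteq> b'" and i: "i < 6"
  shows "E (a i) b \<and> E (a i) b' \<or> E (a i) b \<and> E b b' \<or> E (a i) b' \<and> E b b' \<or>
    E (a ((i + 1) mod 6)) b \<and> E (a ((i + 1) mod 6)) b' \<or>
    E (a ((i + 5) mod 6)) b \<and> E (a ((i + 5) mod 6)) b' \<or>
    (\<exists>m\<in>B. m \<noteq> b \<and> m \<noteq> b' \<and> E (a i) m \<and> E b m \<and> E b' m)"
proof (rule ccontr)
  assume no: "\<not> ?thesis"
  have V: "a i \<in> V" "b \<in> V" "b' \<in> V" using a_in[OF i] b by auto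
  have ne: "b \<noteq> a i" "b' \<noteq> a i" using a_in[OF i] b by auto
  consider "\<not> E b (a i)" "\<not> E (a i) b'" | "\<not> E (a i) b" "\<not> E b b'" | "\<not> E (a i) b'" "\<not> E b' b"
    using no E_commute[of b "a i"] E_commute[of b' b] by blast
  then have "\<exists>x\<in>V. E x (a i) \<and> E x b \<and> E x b'"
  proof cases
    case 1
    then show ?thesis using nonadj_path[OF V(2,1,3)] ne b(3) by auto
  next
    case 2
    then show ?thesis using nonadj_path[OF V] ne b(3) by auto
  next
    case 3
    then show ?thesis using nonadj_path[OF V(1,3,2)] ne b(3) by auto
  qed
  then obtain x where x: "x \<in> V" "E x (a i)" "E x b" "E x b'" by blast
  have "x \<noteq> v" using x b by auto
  then consider "x \<in> A" | "x \<in> B" using x by blast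
  then show False
  proof cases
    case 1
    then obtain j where j: "j < 6" "x = a j" using in_A_obtain by blast
    then have "j = (i + 1) mod 6 \<or> j = (i + 5) mod 6"
      using x(2) a_adj[of j i] less_6_cases[OF i] less_6_cases[OF j(1)] by auto
    then show False using no x j by auto
  next
    case 2
    moreover have "x \<noteq> b" "x \<noteq> b'" using x E_irrefl by blast+
    ultimately show False using no x E_sym by blast
  qed
qed

text \<open>The counterpart of \<open>common_nbr\<close> in the complement; the hexagon offers the
  three positions not adjacent to \<open>i\<close>.\<close>

lemma common_non_nbr:
  assumes b: "b \<in> B" "b' \<in> B" "b \<noteq> b'" and i: "i < 6"
  shows "\<not> E (a i) b \<and> \<not> E (a i) b' \<or> \<not> E (a i) b \<and> \<not> E b b' \<or> \<not> E (a i) b' \<and> \<not> E b b' \<or>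
    (\<exists>j\<in>{2, 3, 4}. \<not> E (a ((i + j) mod 6)) b \<and> \<not> E (a ((i + j) mod 6)) b') \<or>
    (\<exists>m\<in>B. m \<noteq> b \<and> m \<noteq> b' \<and> \<not> E (a i) m \<and> \<not> E b m \<and> \<not> E b' m)"
proof (rule ccontr)
  assume no: "\<not> ?thesis"
  have V: "a i \<in> V" "b \<in> V" "b' \<in> V" using a_in[OF i] b by auto
  have ne: "b \<noteq> a i" "b' \<noteq> a i" using a_in[OF i] b by auto
  consider "E b (a i)" "E (a i) b'" | "E (a i) b" "E b b'" | "E (a i) b'" "E b' b"
    using no E_commute[of b "a i"] E_commute[of b' b] by blast
  then have "\<exists>x\<in>V. x \<notin> {a i, b, b'} \<and> \<not> E x (a i) \<and> \<not> E x b \<and> \<not> E x b'"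
  proof cases
    case 1
    then show ?thesis using adj_path[OF V(2,1,3)] b(3) by auto
  next
    case 2
    then show ?thesis using adj_path[OF V] ne by auto
  next
    case 3
    then show ?thesis using adj_path[OF V(1,3,2)] ne by auto
  qed
  then obtain x where x: "x \<in> V" "x \<notin> {a i, b, b'}" "\<not> E x (a i)" "\<not> E x b" "\<not> E x b'" by blast
  have "x \<noteq> v" using x a_in[OF i] by auto
  then consider "x \<in> A" | "x \<in> B" using x by blast
  then show False
  proof cases
    case 1
    then obtain j where j: "j < 6" "x = a j" using in_A_obtain by blast
    then have "j = (i + 2) mod 6 \<or> j = (i + 3) mod 6 \<or> j = (i + 4) mod 6"
      using x(2,3) a_adj[of j i] less_6_cases[OF i] less_6_cases[OF j(1)] by auto
    then show False using no x(4,5) j by auto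
  next
    case 2
    then show False using no x E_commute[of x] by auto
  qed
qed

section \<open>Numbering the non-neighbours by the hexagon edges that they miss\<close>

definition labelling :: "(nat \<Rightarrow> 'a) \<Rightarrow> bool" where
  "labelling \<beta> \<longleftrightarrow> bij_betw \<beta> {..<8} B \<and>
    (\<forall>i<6. \<not> E (a i) (\<beta> i) \<and> \<not> E (a ((i + 1) mod 6)) (\<beta> i))"

text \<open>Two missed edges contain three consecutive vertices, against \<open>hit\<close>, or
  leave only an antipodal pair, against \<open>hit_off_antipodal\<close>.\<close>

lemma no_two_missed_edges:
  assumes "b \<in> B"
  shows "\<forall>i<6. \<forall>j<6. i < j \<longrightarrow> E (a i) b \<or> E (a ((i + 1) mod 6)) b \<or> E (a j) b \<or> E (a ((j + 1) mod 6)) b"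
proof -
  have "\<forall>i<6. E (a i) b \<or> E (a ((i + 1) mod 6)) b \<or> E (a ((i + 2) mod 6)) b"
    "\<forall>i<3. \<exists>j<6. j mod 3 \<noteq> i \<and> E (a j) b"
    using hit[OF assms] hit_off_antipodal[OF assms] by blast+
  note h = this[simplified less_unfold, simplified, simplified numeral_2_eq_2[symmetric]]
  show ?thesis
    using h unfolding less_unfold by (simp add: numeral_2_eq_2[symmetric]) blast
qed

text \<open>Vertices chosen for different edges differ by \<open>no_two_missed_edges\<close>, which
  leaves two over. A vertex \<open>c\<close> missing no edge is one of these and may be numbered
  6.\<close>

lemma labelling_exists:
  "\<exists>\<beta>. labelling \<beta> \<and> (c \<in> B \<and> (\<forall>i<6. E (a i) c \<or> E (a ((i + 1) mod 6)) c) \<longrightarrow> \<beta> 6 = c)"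
proof -
  have "\<forall>i<6. \<exists>b\<in>B. \<not> E (a i) b \<and> \<not> E (a ((i + 1) mod 6)) b"
  proof (intro allI impI)
    fix i :: nat assume "i < 6"
    then have "a i \<noteq> a ((i + 1) mod 6)"
      using a_eq[of i "(i + 1) mod 6"] less_6_cases[of i] by auto
    then show "\<exists>b\<in>B. \<not> E (a i) b \<and> \<not> E (a ((i + 1) mod 6)) b"
      using miss2[of "a i" "a ((i + 1) mod 6)"] a_in \<open>i < 6\<close> by simp
  qed
  then obtain f where f: "\<And>i. i < 6 \<Longrightarrow> f i \<in> B"
    "\<And>i. i < 6 \<Longrightarrow> \<not> E (a i) (f i) \<and> \<not> E (a ((i + 1) mod 6)) (f i)"
    by metis
  have ne: "f i \<noteq> f j" if "i < j" "j < 6" for i j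
  proof
    assume eq: "f i = f j"
    have "i < 6" using that by simp
    then show False
      using no_two_missed_edges[OF f(1)[OF \<open>j < 6\<close>], rule_format, OF \<open>i < 6\<close> that(2,1)]
        f(2)[of i] f(2)[OF that(2)] unfolding eq by blast
  qed
  have inj: "inj_on f {..<6}"
    by (rule linorder_inj_onI) (use ne in auto)
  have fin: "finite B" using finite_V by simp
  have fB: "f ` {..<6} \<subseteq> B" using f(1) by auto
  have "card (B - f ` {..<6}) = 2"
    using card_image[OF inj] card_B fB fin by (simp add: card_Diff_subset)
  then have "B - f ` {..<6} \<noteq> {}" by (metis card.empty zero_neq_numeral)
  define d where "d = (if c \<in> B \<and> (\<forall>i<6. E (a i) c \<or> E (a ((i + 1) mod 6)) c) then c
    else SOME d. d \<in> B - f ` {..<6})"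
  have d: "d \<in> B - f ` {..<6}"
  proof (cases "c \<in> B \<and> (\<forall>i<6. E (a i) c \<or> E (a ((i + 1) mod 6)) c)")
    case True
    then have "c \<notin> f ` {..<6}" using f(2) by auto
    then show ?thesis using True by (simp add: d_def)
  next
    case False
    then have "d = (SOME d. d \<in> B - f ` {..<6})" unfolding d_def by argo
    then show ?thesis using \<open>B - f ` {..<6} \<noteq> {}\<close> some_in_eq by metis
  qed
  have "card (B - f ` {..<6} - {d}) = 1"
    using \<open>card (B - f ` {..<6}) = 2\<close> d fin by simp
  then obtain e where e: "B - f ` {..<6} - {d} = {e}" by (metis card_1_singletonE)
  define \<beta> where "\<beta> k = (if k < 6 then f k else if k = 6 then d else e)" for k :: nat
  have eight: "{..<8} = {..<6} \<union> {6, 7::nat}" by auto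
  have "\<beta> ` {..<8} = f ` {..<6} \<union> {d, e}"
    unfolding eight image_Un by (auto simp: \<beta>_def)
  also have "\<dots> = B" using e d fB by blast
  finally have image: "\<beta> ` {..<8} = B" .
  then have "inj_on \<beta> {..<8}"
    using card_B by (intro eq_card_imp_inj_on) auto
  then have "labelling \<beta>"
    using image f(2) by (auto simp: labelling_def bij_betw_def \<beta>_def)
  moreover have "c \<in> B \<and> (\<forall>i<6. E (a i) c \<or> E (a ((i + 1) mod 6)) c) \<longrightarrow> \<beta> 6 = c"
    by (simp add: \<beta>_def d_def)
  ultimately show ?thesis by blast
qed

text \<open>Branch sets at hexagon distance 1 are joined by a hexagon edge, at distance 3 by
  \<open>opp\<close>, at distance 2 by \<open>two\<close>, whose uniform direction reaches all such
  pairs.\<close>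

lemma matching_modelI:
  assumes g: "inj_on g {..<6}" "g ` {..<6} \<subseteq> B" and adj: "\<And>j. j < 6 \<Longrightarrow> E (a j) (g j)"
    and opp: "\<And>j. j < 6 \<Longrightarrow> E (a ((j + 3) mod 6)) (g j)"
    and two: "(\<forall>j<6. E (a ((j + 2) mod 6)) (g j)) \<or> (\<forall>j<6. E (a ((j + 4) mod 6)) (g j))"
  shows "matching_model 6 V E v a g"
  unfolding matching_model_def
proof (intro conjI allI impI)
  show "a ` {..<6} \<subseteq> V - {v}" "g ` {..<6} \<subseteq> V - {v} - a ` {..<6}"
    using g a_image E_irrefl by auto
  fix i j :: nat assume ij: "i < 6" "j < i"
  have two': "E (a i) (g j) \<or> E (g i) (a j)" if "i = (j + 2) mod 6 \<or> j = (i + 2) mod 6"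
    using two
  proof
    assume "\<forall>j<6. E (a ((j + 2) mod 6)) (g j)"
    then show ?thesis using that ij E_sym by auto
  next
    assume *: "\<forall>j<6. E (a ((j + 4) mod 6)) (g j)"
    have "j = (i + 4) mod 6 \<or> i = (j + 4) mod 6"
      using that ij less_6_cases[of i] less_6_cases[of j] by auto
    then show ?thesis using * ij E_sym by auto
  qed
  have "i = j + 1 \<or> i = j + 2 \<or> i = j + 3 \<or> i = j + 4 \<or> i = j + 5" using ij by linarith
  then show "E (a i) (a j) \<or> E (a i) (g j) \<or> E (g i) (a j)"
  proof (elim disjE)
    assume "i = j + 3" then show ?thesis using opp[of j] ij by simp
  next
    assume "i = j + 1" then show ?thesis using a_adj[of i j] ij by simp
  next
    assume "i = j + 5" then show ?thesis using a_adj[of i j] ij by simp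
  next
    assume "i = j + 2" then show ?thesis using two' ij by simp
  next
    assume "i = j + 4"
    then have "j = (i + 2) mod 6" using ij by simp
    then show ?thesis using two' by simp
  qed
qed (use g a_inj v_in a_in adj in auto)

lemma labelling_props:
  assumes "labelling \<beta>"
  shows "k < 8 \<Longrightarrow> \<beta> k \<in> B" and "k < 8 \<Longrightarrow> l < 8 \<Longrightarrow> \<beta> k = \<beta> l \<longleftrightarrow> k = l"
    and "b \<in> B \<Longrightarrow> \<exists>k<8. b = \<beta> k"
    and "i < 6 \<Longrightarrow> \<not> E (a i) (\<beta> i) \<and> \<not> E (a ((i + 1) mod 6)) (\<beta> i)"
proof -
  have im: "\<beta> ` {..<8} = B" and inj: "inj_on \<beta> {..<8}"
    using assms by (auto simp: labelling_def bij_betw_def)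
  show "k < 8 \<Longrightarrow> \<beta> k \<in> B" "b \<in> B \<Longrightarrow> \<exists>k<8. b = \<beta> k"
    using im by auto
  show "k < 8 \<Longrightarrow> l < 8 \<Longrightarrow> \<beta> k = \<beta> l \<longleftrightarrow> k = l" using inj by (auto simp: inj_on_def)
  show "i < 6 \<Longrightarrow> \<not> E (a i) (\<beta> i) \<and> \<not> E (a ((i + 1) mod 6)) (\<beta> i)"
    using assms by (simp add: labelling_def)
qed

text \<open>By \<open>hit\<close>, the vertex numbered \<open>i\<close> sees \<open>i + 2\<close>
  and \<open>i + 5\<close>. With \<open>i + 4\<close> it is matched to position
  \<open>i + 2\<close>, with \<open>i + 3\<close> to position \<open>i + 5\<close>; the shifts by 4
  and 1 invert these assignments.\<close>

lemma labelling_model: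
  assumes \<beta>: "labelling \<beta>"
    and all: "(\<forall>i<6. E (a ((i + 4) mod 6)) (\<beta> i)) \<or> (\<forall>i<6. E (a ((i + 3) mod 6)) (\<beta> i))"
  shows "\<exists>g. matching_model 6 V E v a g"
proof -
  note props = labelling_props[OF \<beta>]
  have two: "E (a ((i + 2) mod 6)) (\<beta> i)" "E (a ((i + 5) mod 6)) (\<beta> i)" if "i < 6" for i
    using hit[OF props(1), of i i] hit[OF props(1), of i "(i + 5) mod 6"] props(4)[OF that]
      less_6_cases[OF that] by (auto simp: numeral_2_eq_2[symmetric])
  have shift: "inj_on (\<lambda>j. \<beta> ((j + c) mod 6)) {..<6}" "(\<lambda>j. \<beta> ((j + c) mod 6)) ` {..<6} \<subseteq> B"
    if "c = 4 \<or> c = 1" for c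
  proof -
    have lt: "(i + c) mod 6 < 8" for i
      using mod_less_divisor[of 6 "i + c"] by linarith
    show "inj_on (\<lambda>j. \<beta> ((j + c) mod 6)) {..<6}"
    proof (rule inj_onI)
      fix i j :: nat assume ij: "i \<in> {..<6}" "j \<in> {..<6}" "\<beta> ((i + c) mod 6) = \<beta> ((j + c) mod 6)"
      then have "(i + c) mod 6 = (j + c) mod 6" using props(2)[OF lt lt] by simp
      then show "i = j"
        using ij(1,2) \<open>c = 4 \<or> c = 1\<close> less_6_cases[of i] less_6_cases[of j] by auto
    qed
    show "(\<lambda>j. \<beta> ((j + c) mod 6)) ` {..<6} \<subseteq> B"
      using props(1)[OF lt] by blast
  qed
  show ?thesis
    using all
  proof
    assume *: "\<forall>i<6. E (a ((i + 4) mod 6)) (\<beta> i)"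
    have "matching_model 6 V E v a (\<lambda>j. \<beta> ((j + 4) mod 6))"
    proof (rule matching_modelI)
      fix j :: nat assume j: "j < 6"
      show "E (a j) (\<beta> ((j + 4) mod 6))" "E (a ((j + 3) mod 6)) (\<beta> ((j + 4) mod 6))"
        using two[of "(j + 4) mod 6"] less_6_cases[OF j] by (auto simp: numeral_2_eq_2[symmetric])
    next
      have "E (a ((j + 2) mod 6)) (\<beta> ((j + 4) mod 6))" if j: "j < 6" for j
        using *[rule_format, of "(j + 4) mod 6"] less_6_cases[OF j] by (auto simp: numeral_2_eq_2[symmetric])
      then show "(\<forall>j<6. E (a ((j + 2) mod 6)) (\<beta> ((j + 4) mod 6))) \<or>
        (\<forall>j<6. E (a ((j + 4) mod 6)) (\<beta> ((j + 4) mod 6)))" by blast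
    qed (rule shift, simp)+
    then show ?thesis by blast
  next
    assume *: "\<forall>i<6. E (a ((i + 3) mod 6)) (\<beta> i)"
    have "matching_model 6 V E v a (\<lambda>j. \<beta> ((j + 1) mod 6))"
    proof (rule matching_modelI)
      fix j :: nat assume j: "j < 6"
      show "E (a j) (\<beta> ((j + 1) mod 6))" "E (a ((j + 3) mod 6)) (\<beta> ((j + 1) mod 6))"
        using two[of "(j + 1) mod 6"] less_6_cases[OF j] by (auto simp: numeral_2_eq_2[symmetric])
    next
      have "E (a ((j + 4) mod 6)) (\<beta> ((j + 1) mod 6))" if j: "j < 6" for j
        using *[rule_format, of "(j + 1) mod 6"] less_6_cases[OF j] by (auto simp: numeral_2_eq_2[symmetric])
      then show "(\<forall>j<6. E (a ((j + 2) mod 6)) (\<beta> ((j + 1) mod 6))) \<or>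
        (\<forall>j<6. E (a ((j + 4) mod 6)) (\<beta> ((j + 1) mod 6)))" by blast
    qed (rule shift, simp)+
    then show ?thesis by blast
  qed
qed

lemma labelling_code:
  assumes \<beta>: "labelling \<beta>" and no: "\<nexists>g. matching_model 6 V E v a g"
  shows "hexagon_code_edges (\<lambda>k i. E (a i) (\<beta> k)) (\<lambda>k l. E (\<beta> k) (\<beta> l))"
proof
  note props = labelling_props[OF \<beta>]
  have B_ex: "(\<exists>m\<in>B. Q m) \<longleftrightarrow> (\<exists>m<8. Q (\<beta> m))" for Q
    using props(1,3) by blast
  show "\<forall>k<8. \<forall>i<6. E (a i) (\<beta> k) \<or> E (a ((i + 1) mod 6)) (\<beta> k) \<or> E (a ((i + 2) mod 6)) (\<beta> k)"
    using hit[OF props(1)] by blast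
  show "\<forall>k<8. \<forall>i<3. \<exists>j<6. j mod 3 \<noteq> i \<and> E (a j) (\<beta> k)"
    using hit_off_antipodal[OF props(1)] by blast
  show "\<forall>i<6. \<not> E (a i) (\<beta> i) \<and> \<not> E (a ((i + 1) mod 6)) (\<beta> i)"
    using props(4) by blast
  show "\<forall>k<8. \<forall>l<8. k < l \<longrightarrow> (\<exists>i<6. E (a i) (\<beta> k) \<and> E (a i) (\<beta> l))"
    using meet[OF props(1) props(1)] in_A_obtain by metis
  show "\<forall>i<6. \<exists>k<8. \<not> E (a i) (\<beta> k) \<and> \<not> E (a ((i + 2) mod 6)) (\<beta> k)"
  proof (intro allI impI)
    fix i :: nat assume i: "i < 6"
    then have "a i \<noteq> a ((i + 2) mod 6)"
      using a_eq[of i "(i + 2) mod 6"] less_6_cases[of i] by auto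
    then show "\<exists>k<8. \<not> E (a i) (\<beta> k) \<and> \<not> E (a ((i + 2) mod 6)) (\<beta> k)"
      using miss2[OF a_in a_in, of i "(i + 2) mod 6", unfolded B_ex] i by simp
  qed
  show "\<forall>i<3. \<forall>l<8. \<exists>k<8. k \<noteq> l \<and> \<not> E (a i) (\<beta> k) \<and> \<not> E (a (i + 3)) (\<beta> k)"
  proof (intro allI impI)
    fix i l :: nat assume "i < 3" "l < 8"
    from antipodal_missed[OF this(1), of "\<beta> l", unfolded B_ex]
    show "\<exists>k<8. k \<noteq> l \<and> \<not> E (a i) (\<beta> k) \<and> \<not> E (a (i + 3)) (\<beta> k)" by blast
  qed
  show "\<not> (\<forall>i<6. E (a ((i + 4) mod 6)) (\<beta> i))" "\<not> (\<forall>i<6. E (a ((i + 3) mod 6)) (\<beta> i))"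
    using labelling_model[OF \<beta>] no by blast+
  show "E (\<beta> k) (\<beta> l) = E (\<beta> l) (\<beta> k)" for k l by (rule E_commute)
  show "\<forall>i<3. \<forall>k<8. E (a i) (\<beta> k) \<and> E (a (i + 3)) (\<beta> k) \<or>
    (\<exists>l<8. l \<noteq> k \<and> E (\<beta> k) (\<beta> l) \<and> E (a i) (\<beta> l) \<and> E (a (i + 3)) (\<beta> l))"
  proof (intro allI impI)
    fix i k :: nat assume "i < 3" "k < 8"
    from antipodal_common[OF props(1)[OF this(2)] this(1), unfolded B_ex] show "E (a i) (\<beta> k) \<and> E (a (i + 3)) (\<beta> k) \<or>
      (\<exists>l<8. l \<noteq> k \<and> E (\<beta> k) (\<beta> l) \<and> E (a i) (\<beta> l) \<and> E (a (i + 3)) (\<beta> l))"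
      by blast
  qed
  show "\<forall>i<6. \<forall>k<8. \<forall>l<8. k < l \<longrightarrow> E (a i) (\<beta> k) \<and> E (a i) (\<beta> l) \<or>
    E (a i) (\<beta> k) \<and> E (\<beta> k) (\<beta> l) \<or> E (a i) (\<beta> l) \<and> E (\<beta> k) (\<beta> l) \<or>
    E (a ((i + 1) mod 6)) (\<beta> k) \<and> E (a ((i + 1) mod 6)) (\<beta> l) \<or>
    E (a ((i + 5) mod 6)) (\<beta> k) \<and> E (a ((i + 5) mod 6)) (\<beta> l) \<or>
    (\<exists>m<8. m \<noteq> k \<and> m \<noteq> l \<and> E (a i) (\<beta> m) \<and> E (\<beta> k) (\<beta> m) \<and> E (\<beta> l) (\<beta> m))"
    (is "\<forall>i<6. \<forall>k<8. \<forall>l<8. k < l \<longrightarrow> ?P i k l")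
  proof (intro allI impI)
    fix i k l :: nat assume i: "i < 6" and kl: "k < 8" "l < 8" "k < l"
    then have "\<beta> k \<noteq> \<beta> l" using props(2) by simp
    from common_nbr[OF props(1)[OF kl(1)] props(1)[OF kl(2)] this i, unfolded B_ex]
    show "?P i k l" by blast
  qed
  show "\<forall>i<6. \<forall>k<8. \<forall>l<8. k < l \<longrightarrow> \<not> E (a i) (\<beta> k) \<and> \<not> E (a i) (\<beta> l) \<or>
    \<not> E (a i) (\<beta> k) \<and> \<not> E (\<beta> k) (\<beta> l) \<or> \<not> E (a i) (\<beta> l) \<and> \<not> E (\<beta> k) (\<beta> l) \<or>
    (\<exists>j\<in>{2, 3, 4}. \<not> E (a ((i + j) mod 6)) (\<beta> k) \<and> \<not> E (a ((i + j) mod 6)) (\<beta> l)) \<or>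
    (\<exists>m<8. m \<noteq> k \<and> m \<noteq> l \<and> \<not> E (a i) (\<beta> m) \<and> \<not> E (\<beta> k) (\<beta> m) \<and> \<not> E (\<beta> l) (\<beta> m))"
    (is "\<forall>i<6. \<forall>k<8. \<forall>l<8. k < l \<longrightarrow> ?P i k l")
  proof (intro allI impI)
    fix i k l :: nat assume i: "i < 6" and kl: "k < 8" "l < 8" "k < l"
    then have "\<beta> k \<noteq> \<beta> l" using props(2) by simp
    from common_non_nbr[OF props(1)[OF kl(1)] props(1)[OF kl(2)] this i, unfolded B_ex]
    show "?P i k l" by blast
  qed
qed

text \<open>The vertex \<open>c\<close> misses no edge and can be numbered 6, where
  \<open>not_alternating\<close> refutes it.\<close>

lemma alternating_model:
  assumes c: "c \<in> B" "\<forall>i<6. E (a i) c \<longleftrightarrow> odd i"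
  shows "\<exists>g. matching_model 6 V E v a g"
proof (rule ccontr)
  assume no: "\<not> ?thesis"
  have "\<forall>i<6. E (a i) c \<or> E (a ((i + 1) mod 6)) c"
    using c(2) less_6_cases by auto
  then obtain \<beta> where \<beta>: "labelling \<beta>" "\<beta> 6 = c"
    using labelling_exists[of c] c(1) by blast
  interpret hexagon_code_edges "\<lambda>k i. E (a i) (\<beta> k)" "\<lambda>k l. E (\<beta> k) (\<beta> l)"
    using labelling_code[OF \<beta>(1) no] .
  show False using not_alternating c(2) \<beta>(2) by simp
qed

text \<open>Exchanges the even and the odd positions, so that one parity of an alternating trace
  suffices.\<close>

lemma rotated: "hexagon V E v (\<lambda>i. a ((i + 1) mod 6))"
proof
  have inj: "inj_on (\<lambda>i. (i + 1) mod 6) {..<6::nat}"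
  proof (rule inj_onI)
    fix i j :: nat assume "i \<in> {..<6}" "j \<in> {..<6}" "(i + 1) mod 6 = (j + 1) mod 6"
    then show "i = j" using less_6_cases[of i] less_6_cases[of j] by auto
  qed
  have im: "(\<lambda>i. (i + 1) mod 6) ` {..<6::nat} = {..<6}"
    using inj by (intro card_subset_eq) (auto simp: card_image)
  show "(\<lambda>i. a ((i + 1) mod 6)) ` {..<6} = A"
    using a_image im by (metis image_image)
  show "inj_on (\<lambda>i. a ((i + 1) mod 6)) {..<6}"
    using comp_inj_on[OF inj, of a] a_inj unfolding im comp_def by blast
  have "\<forall>i<6. \<forall>j<6. (j + 1) mod 6 = ((i + 1) mod 6 + 1) mod 6 \<longleftrightarrow> j = (i + 1) mod (6::nat)"
    unfolding less_unfold by simp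
  then have shift: "(j + 1) mod 6 = ((i + 1) mod 6 + 1) mod 6 \<longleftrightarrow> j = (i + 1) mod 6"
    if "i < 6" "j < 6" for i j :: nat
    using that by blast
  fix i j :: nat assume ij: "i < 6" "j < 6"
  have "(i + 1) mod 6 < 6" "(j + 1) mod 6 < 6" by simp_all
  from a_adj[OF this, unfolded shift[OF ij] shift[OF ij(2,1)]]
  show "E (a ((i + 1) mod 6)) (a ((j + 1) mod 6)) \<longleftrightarrow> j = (i + 1) mod 6 \<or> i = (j + 1) mod 6" .
qed

lemma model_exists: "\<exists>a g. matching_model 6 V E v a g"
proof (rule ccontr)
  assume no: "\<not> ?thesis"
  obtain \<beta> where \<beta>: "labelling \<beta>" using labelling_exists by blast
  interpret code: hexagon_code_edges "\<lambda>k i. E (a i) (\<beta> k)" "\<lambda>k l. E (\<beta> k) (\<beta> l)"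
    using labelling_code[OF \<beta>] no by blast
  interpret rot: hexagon V E v "\<lambda>i. a ((i + 1) mod 6)" by (rule rotated)
  have "\<exists>c\<in>B. (\<forall>i<6. E (a i) c \<longleftrightarrow> odd i) \<or> (\<forall>i<6. E (a i) c \<longleftrightarrow> even i)"
    using code.alternating labelling_props(1)[OF \<beta>, of 6] labelling_props(1)[OF \<beta>, of 7]
    unfolding less_unfold by (auto 0 4)
  then obtain c where c: "c \<in> B" "(\<forall>i<6. E (a i) c \<longleftrightarrow> odd i) \<or> (\<forall>i<6. E (a i) c \<longleftrightarrow> even i)" by blast
  show False
    using c(2)
  proof
    assume "\<forall>i<6. E (a i) c \<longleftrightarrow> odd i"
    then show False using alternating_model c(1) no by blast
  next
    assume *: "\<forall>i<6. E (a i) c \<longleftrightarrow> even i"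
    have "\<forall>i<6. E (a ((i + 1) mod 6)) c \<longleftrightarrow> odd i"
    proof (intro allI impI)
      fix i :: nat assume i: "i < 6"
      show "E (a ((i + 1) mod 6)) c \<longleftrightarrow> odd i"
        using *[rule_format, of "(i + 1) mod 6"] less_6_cases[OF i] by auto
    qed
    then show False using rot.alternating_model c(1) no by blast
  qed
qed

end

section \<open>Complete minors from a vertex of degree six\<close>

context noncompliant_at
begin

lemma hexagon_of_cycle:
  assumes A: "A = {a0, a1, a2, a3, a4, a5}" and dist: "distinct [a0, a1, a2, a3, a4, a5]"
    and adj: "E a0 a1" "E a1 a2" "E a2 a3" "E a3 a4" "E a4 a5" "E a5 a0"
    and non: "\<not> E a0 a2" "\<not> E a0 a3" "\<not> E a0 a4" "\<not> E a1 a3" "\<not> E a1 a4" "\<not> E a1 a5"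
      "\<not> E a2 a4" "\<not> E a2 a5" "\<not> E a3 a5"
  shows "hexagon V E v (\<lambda>i. [a0, a1, a2, a3, a4, a5] ! i)"
proof unfold_locales
  let ?l = "[a0, a1, a2, a3, a4, a5]"
  have "(\<lambda>i. ?l ! i) ` {..<6} = set ?l"
    by (force simp: set_conv_nth)
  then show "(\<lambda>i. ?l ! i) ` {..<6} = A" unfolding A by simp
  show "inj_on (\<lambda>i. ?l ! i) {..<6}"
    using inj_on_nth[OF dist, of "{..<6}"] by simp
  have non': "\<not> E a2 a0" "\<not> E a3 a0" "\<not> E a4 a0" "\<not> E a3 a1" "\<not> E a4 a1" "\<not> E a5 a1"
      "\<not> E a4 a2" "\<not> E a5 a2" "\<not> E a5 a3" and adj': "E a1 a0" "E a2 a1" "E a3 a2" "E a4 a3" "E a5 a4" "E a0 a5"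
    using adj non E_sym by blast+
  have "\<forall>i<6. \<forall>j<6. E (?l ! i) (?l ! j) \<longleftrightarrow> j = (i + 1) mod 6 \<or> i = (j + 1) mod 6"
    unfolding less_unfold using adj non adj' non' E_irrefl by simp
  then show "E (?l ! i) (?l ! j) \<longleftrightarrow> j = (i + 1) mod 6 \<or> i = (j + 1) mod 6" if "i < 6" "j < 6" for i j
    using that by blast
qed

lemma model_of_degree_6:
  assumes "card A = 6"
  shows "\<exists>a g. matching_model 6 V E v a g"
proof -
  obtain a x y w p q where A: "A = {a, x, y, w, p, q}" and dist: "distinct [a, x, y, w, p, q]"
    and e: "E a x" "E a y" "\<not> E a w" "\<not> E a p" "\<not> E a q" "\<not> E w x" "\<not> E w y" "E w p" "E w q"
    and cases: "E x y \<and> E p q \<or> \<not> E x y \<and> \<not> E p q \<and>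
      (E x p \<and> E y q \<and> \<not> E x q \<and> \<not> E y p \<or> E x q \<and> E y p \<and> \<not> E x p \<and> \<not> E y q)"
    by (rule A_structure[OF assms])
  have "\<not> (E x y \<and> E p q)"
    using no_two_triangles[OF assms A dist e(1,2) _ e(8,9) _ e(3-7)] by blast
  with cases have ne: "\<not> E x y" "\<not> E p q" and
    "E x p \<and> E y q \<and> \<not> E x q \<and> \<not> E y p \<or> E x q \<and> E y p \<and> \<not> E x p \<and> \<not> E y q" by blast+
  \<comment> \<open>Here \<open>p'\<close> is the neighbour of \<open>x\<close> among
    \<open>p\<close> and \<open>q\<close>, and \<open>q'\<close> that of \<open>y\<close>; this
    fixes the cyclic order.\<close>
  then obtain p' q' where pq: "{p', q'} = {p, q}" "E x p'" "E y q'" "\<not> E x q'" "\<not> E y p'"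
    by (metis insert_commute)
  have "p' \<noteq> q'" using pq by blast
  have "hexagon V E v (\<lambda>i. [a, x, p', w, q', y] ! i)"
  proof (rule hexagon_of_cycle)
    have "A = {a, x, y, w} \<union> {p', q'}" unfolding pq(1) A by auto
    then show "A = {a, x, p', w, q', y}" by auto
    have "p' \<in> {p, q}" "q' \<in> {p, q}" unfolding pq(1)[symmetric] by auto
    then show "distinct [a, x, p', w, q', y]" using dist \<open>p' \<noteq> q'\<close> by auto
    show "E a x" "E x p'" "E p' w" "E w q'" "E q' y" "E y a"
      using e pq(2,3) \<open>p' \<in> {p, q}\<close> \<open>q' \<in> {p, q}\<close> E_commute[of y] E_commute[of _ w] by auto
    show "\<not> E a p'" "\<not> E a w" "\<not> E a q'" "\<not> E x w" "\<not> E x q'" "\<not> E x y"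
      "\<not> E p' q'" "\<not> E p' y" "\<not> E w y"
      using e pq(4,5) ne \<open>p' \<in> {p, q}\<close> \<open>q' \<in> {p, q}\<close> \<open>p' \<noteq> q'\<close>
        E_commute[of p q] E_commute[of p' y] E_commute[of x w] by auto
  qed
  then interpret hexagon V E v "\<lambda>i. [a, x, p', w, q', y] ! i" .
  show ?thesis by (rule model_exists)
qed

end

section \<open>Parity and the choice of the vertex\<close>

context noncompliant
begin

text \<open>The handshake argument: a new vertex \<open>w\<close> contributes two arcs for each of
  its neighbours.\<close>

lemma even_card_arcs: "finite W \<Longrightarrow> even (card {(x, y). x \<in> W \<and> y \<in> W \<and> E x y})"
proof (induction W rule: finite_induct)
  case (insert w W)
  let ?old = "{(x, y). x \<in> W \<and> y \<in> W \<and> E x y}"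
  let ?N = "{x \<in> W. E w x}"
  have eq: "{(x, y). x \<in> insert w W \<and> y \<in> insert w W \<and> E x y} = ?old \<union> (Pair w ` ?N \<union> (\<lambda>x. (x, w)) ` ?N)"
    using E_irrefl E_commute[of _ w] by auto
  have fin: "finite ?old" "finite ?N"
    using insert(1) finite_subset[of ?old "W \<times> W"] by auto
  have "card (Pair w ` ?N \<union> (\<lambda>x. (x, w)) ` ?N) = card ?N + card ?N"
    using fin insert(2) by (subst card_Un_disjoint) (auto simp: card_image inj_on_def)
  moreover have "card (?old \<union> (Pair w ` ?N \<union> (\<lambda>x. (x, w)) ` ?N)) = card ?old + card (Pair w ` ?N \<union> (\<lambda>x. (x, w)) ` ?N)"
    using fin insert(2) by (intro card_Un_disjoint) auto
  ultimately show ?case using insert.IH unfolding eq by simp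
qed simp

text \<open>Otherwise there would be 15 * 7 = 105 arcs, an odd number.\<close>

lemma degree_not_7: "\<exists>v\<in>V. card {a \<in> V. E v a} \<noteq> 7"
proof (rule ccontr)
  assume "\<not> ?thesis"
  then have seven: "\<And>v. v \<in> V \<Longrightarrow> card {a \<in> V. E v a} = 7" by blast
  have "{(x, y). x \<in> V \<and> y \<in> V \<and> E x y} = Sigma V (\<lambda>v. {a \<in> V. E v a})" by auto
  then have "card {(x, y). x \<in> V \<and> y \<in> V \<and> E x y} = (\<Sum>v\<in>V. card {a \<in> V. E v a})"
    using finite_V by simp
  also have "\<dots> = 105" using seven card_V by simp
  finally show False using even_card_arcs[OF finite_V] by simp
qed

text \<open>The degrees of \<open>v\<close> in the graph and in its complement add up to 14, and
  both are at least 6. As they are not 7, one of them is 6.\<close>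

lemma model_exists:
  "\<exists>v a g. matching_model 6 V E v a g \<or> matching_model 6 V (\<lambda>x y. x \<noteq> y \<and> \<not> E x y) v a g"
proof -
  obtain v where v: "v \<in> V" "card {a \<in> V. E v a} \<noteq> 7" using degree_not_7 by blast
  interpret G: noncompliant_at V E v by unfold_locales (rule v)
  interpret C: noncompliant V "\<lambda>x y. x \<noteq> y \<and> \<not> E x y" by (rule complement_noncompliant)
  interpret C: noncompliant_at V "\<lambda>x y. x \<noteq> y \<and> \<not> E x y" v by unfold_locales (rule v)
  have "card {b \<in> V. b \<noteq> v \<and> \<not> E v b} = card {a \<in> V. v \<noteq> a \<and> \<not> E v a}"
    by (rule arg_cong[where f = card]) auto
  then have "card {a \<in> V. E v a} = 6 \<or> card {a \<in> V. v \<noteq> a \<and> \<not> E v a} = 6"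
    using G.card_A_B G.card_A_ge C.card_A_ge v(2) by linarith
  then show ?thesis using G.model_of_degree_6 C.model_of_degree_6 by blast
qed

end

section \<open>The adjacency conditions from the degree bound on minors\<close>

lemma edge_missed:
  assumes F: "pair_graph F" "card (pverts F) = 15" and small: "\<And>H. is_minor H F \<Longrightarrow> max_degree H < 12"
    and uw: "(u, w) \<in> parcs F"
  shows "\<exists>x\<in>pverts F. x \<notin> {u, w} \<and> (x, u) \<notin> parcs F \<and> (x, w) \<notin> parcs F"
proof (rule ccontr)
  assume no: "\<not> ?thesis"
  have sym: "(y, x) \<in> parcs F" if "(x, y) \<in> parcs F" for x y
    using F(1) that by (auto simp: pair_graph_iff sym_def)
  obtain H where "is_minor H F" "card (pverts F - {u, w}) \<le> max_degree H"
  proof -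
    have "(u, x) \<in> parcs F \<or> (w, x) \<in> parcs F" if "x \<in> pverts F - {u, w}" for x
      using no that sym[of x u] sym[of x w] by blast
    from contract_edge_star[OF F(1) uw subset_refl this] show thesis using that by blast
  qed
  moreover have "card (pverts F) - card {u, w} \<le> card (pverts F - {u, w})"
    by (rule diff_card_le_card_Diff) simp
  moreover have "card {u, w} \<le> 2" by (simp add: card_insert_if)
  ultimately show False using small[of H] F(2) by linarith
qed

text \<open>Otherwise contracting the path yields a vertex of degree at least 15 - 3 = 12, just
  enough to contradict \<open>small\<close>.\<close>

lemma path_missed:
  assumes F: "pair_graph F" "card (pverts F) = 15" and small: "\<And>H. is_minor H F \<Longrightarrow> max_degree H < 12"
    and path: "(u, v) \<in> parcs F" "(v, w) \<in> parcs F" "u \<noteq> w"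
  shows "\<exists>x\<in>pverts F. x \<notin> {u, v, w} \<and> (x, u) \<notin> parcs F \<and> (x, v) \<notin> parcs F \<and> (x, w) \<notin> parcs F"
proof (rule ccontr)
  assume no: "\<not> ?thesis"
  have sym: "(y, x) \<in> parcs F" if "(x, y) \<in> parcs F" for x y
    using F(1) that by (auto simp: pair_graph_iff sym_def)
  obtain H where "is_minor H F" "card (pverts F - {u, v, w}) \<le> max_degree H"
  proof -
    have "(u, x) \<in> parcs F \<or> (v, x) \<in> parcs F \<or> (w, x) \<in> parcs F" if "x \<in> pverts F - {u, v, w}" for x
      using no that sym[of x u] sym[of x v] sym[of x w] by blast
    from contract_path_star[OF F(1) sym[OF path(1)] path(2,3) subset_refl this] show thesis using that by blast
  qed
  moreover have "card (pverts F) - card {u, v, w} \<le> card (pverts F - {u, v, w})"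
    by (rule diff_card_le_card_Diff) simp
  moreover have "card {u, v, w} \<le> 3" by (simp add: card_insert_if)
  ultimately show False using small[of H] F(2) by linarith
qed

text \<open>The conditions on non-adjacent vertices are \<open>edge_missed\<close> and
  \<open>path_missed\<close> for the complement.\<close>

lemma noncompliant_of_small_degree:
  assumes G: "pair_graph G" "card (pverts G) = 15"
    and small: "\<And>H. is_minor H G \<Longrightarrow> max_degree H < 12"
      "\<And>H. is_minor H (complement G) \<Longrightarrow> max_degree H < 12"
  shows "noncompliant (pverts G) (\<lambda>x y. (x, y) \<in> parcs G)"
proof
  have C: "pair_graph (complement G)" "card (pverts (complement G)) = 15"
    using G pair_graph_complement by (auto simp: complement_def)
  have arc_C: "(x, y) \<in> parcs (complement G) \<longleftrightarrow> x \<in> pverts G \<and> y \<in> pverts G \<and> x \<noteq> y \<and> (x, y) \<notin> parcs G"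
    and pverts_C: "pverts (complement G) = pverts G" for x y
    by (auto simp: complement_def)
  show "card (pverts G) = 15" by fact
  show "(y, x) \<in> parcs G" if "(x, y) \<in> parcs G" for x y
    using G(1) that by (auto simp: pair_graph_iff sym_def)
  show "(x, x) \<notin> parcs G" for x
    using G(1) by (auto simp: pair_graph_iff irrefl_def)
  show "\<exists>x\<in>pverts G. x \<notin> {u, w} \<and> (x, u) \<notin> parcs G \<and> (x, w) \<notin> parcs G" if "(u, w) \<in> parcs G" for u w
    by (rule edge_missed[OF G small(1) that])
  show "\<exists>x\<in>pverts G. (x, u) \<in> parcs G \<and> (x, w) \<in> parcs G"
    if "u \<in> pverts G" "w \<in> pverts G" "u \<noteq> w" "(u, w) \<notin> parcs G" for u w
    using edge_missed[OF C small(2), of u w] that unfolding arc_C pverts_C by blast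
  show "\<exists>x\<in>pverts G. x \<notin> {u, v, w} \<and> (x, u) \<notin> parcs G \<and> (x, v) \<notin> parcs G \<and> (x, w) \<notin> parcs G"
    if "u \<noteq> w" "(u, v) \<in> parcs G" "(v, w) \<in> parcs G" for u v w
    by (rule path_missed[OF G small(1) that(2,3,1)])
  show "\<exists>x\<in>pverts G. (x, u) \<in> parcs G \<and> (x, v) \<in> parcs G \<and> (x, w) \<in> parcs G"
    if "u \<in> pverts G" "v \<in> pverts G" "w \<in> pverts G" "distinct [u, v, w]" "(u, v) \<notin> parcs G" "(v, w) \<notin> parcs G"
    for u v w
    using path_missed[OF C small(2), of u v w] that unfolding arc_C pverts_C by auto
qed

text \<open>The negated arc relation also holds for pairs outside the vertex set, so it is compared
  with the arcs of the complement on \<open>V\<close> only.\<close>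

lemma matching_model_mono:
  assumes M: "matching_model n V E v a b" and mono: "\<And>x y. x \<in> V \<Longrightarrow> y \<in> V \<Longrightarrow> E x y \<Longrightarrow> E' x y"
  shows "matching_model n V E' v a b"
proof -
  have V: "v \<in> V" "\<And>i. i < n \<Longrightarrow> a i \<in> V" "\<And>i. i < n \<Longrightarrow> b i \<in> V"
    using M unfolding matching_model_def by auto
  have "E' (a i) (a j) \<or> E' (a i) (b j) \<or> E' (b i) (a j)" if "i < n" "j < i" for i j
  proof -
    have "j < n" using that by simp
    then show ?thesis
      using M that mono[OF V(2) V(2), of i j] mono[OF V(2) V(3), of i j] mono[OF V(3) V(2), of i j]
      unfolding matching_model_def by blast
  qed
  moreover have "E' v (a i) \<and> E' (a i) (b i)" if "i < n" for i
    using M that mono[OF V(1) V(2), of i] mono[OF V(2) V(3), of i i] unfolding matching_model_def by blast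
  ultimately show ?thesis
    using M unfolding matching_model_def by blast
qed

theorem theorem18:
  fixes G :: "'a pair_pre_digraph"
  assumes "pair_graph G" and "card (pverts G) = 15"
  shows "compliant 3 G \<or> has_complete_minor 7 G \<or> has_complete_minor 7 (complement G)"
proof (cases "compliant 3 G")
  case False
  have "max_degree H < 12" if "is_minor H G \<or> is_minor H (complement G)" for H
  proof (rule ccontr)
    assume "\<not> ?thesis"
    then have "compliant 3 G"
      using that assms(2) unfolding compliant_def by (intro exI[of _ H]) simp
    with False show False ..
  qed
  then interpret noncompliant "pverts G" "\<lambda>x y. (x, y) \<in> parcs G"
    using noncompliant_of_small_degree[OF assms] by blast
  obtain v a b where "matching_model 6 (pverts G) (\<lambda>x y. (x, y) \<in> parcs G) v a b \<or>
    matching_model 6 (pverts G) (\<lambda>x y. x \<noteq> y \<and> (x, y) \<notin> parcs G) v a b"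
    using model_exists by blast
  then show ?thesis
  proof
    assume "matching_model 6 (pverts G) (\<lambda>x y. (x, y) \<in> parcs G) v a b"
    from complete_minor_of_matching_model[OF assms(1) this]
    have "has_complete_minor 7 G" by simp
    then show ?thesis by blast
  next
    assume "matching_model 6 (pverts G) (\<lambda>x y. x \<noteq> y \<and> (x, y) \<notin> parcs G) v a b"
    then have "matching_model 6 (pverts G) (\<lambda>x y. (x, y) \<in> parcs (complement G)) v a b"
      by (rule matching_model_mono) (simp add: complement_def)
    then have "matching_model 6 (pverts (complement G)) (\<lambda>x y. (x, y) \<in> parcs (complement G)) v a b"
      by (simp add: complement_def)
    from complete_minor_of_matching_model[OF pair_graph_complement[OF assms(1)] this]
    have "has_complete_minor 7 (complement G)" by simp
    then show ?thesis by blast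
  qed
qed (rule disjI1)

end
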